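(* Let $X$ be an effective topological space. If $X$ admits a computably admissible representation $\delta$ whose domain $\mathrm{dom}(\delta)$ is a computably overt $\Pi^0_2$-subset of $\mathbb{N}^{\mathbb{N}}$, then $X$ is an effective quasi-Polish space.
   Context: Let $(W_e)$ be a standard enumeration of c.e. sets. An effective topological space is a countably based $T_0$ space $X$ with a numbering $(B_i)_{i\in\mathbb{N}}$ of a basis such that for some computable $f$, $B_i\cap B_j=\bigcup_{k\in W_{f(i,j)}}B_k$. Effective open sets are $\bigcup_{i\in W}B_i$, $W$ c.e.; uniformly effective open means computably given indices. In $\mathbb{N}^{\mathbb{N}}$ (basis the cylinders $[\sigma]$), $\Sigma^0_2$ sets are $\bigcup_n(U_n\setminus V_n)$ with $U_n,V_n$ uniformly effective open, $\Pi^0_2$ sets are their complements, and $A$ is computably overt if $\{\sigma:[\sigma]\cap A\neq\emptyset\}$ is c.e. Let $e(x)=\{n:x\in B_n\}$ (canonical embedding into $\mathcal{P}(\omega)$) and $\rho(p)=\{n:\exists i\,p(i)=n+1\}$; the standard representation $\rho_X$ has domain $\rho^{-1}(e[X])$ and $\rho_X(p)=e^{-1}(\rho(p))$. A representation of $X$ is a partial surjection $\delta:\subseteq\mathbb{N}^{\mathbb{N}}\to X$; it is computably admissible if it is computably equivalent to $\rho_X$, i.e. there are partial computable $F,G:\subseteq\mathbb{N}^{\mathbb{N}}\to\mathbb{N}^{\mathbb{N}}$ with $\rho_X=\delta\circ F$ and $\delta=\rho_X\circ G$. $X$ is an effective quasi-Polish space if $X$ is empty or $X$ is the image of $\mathbb{N}^{\mathbb{N}}$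 under a map $f$ that is computable ($f^{-1}(B_i)$ uniformly effective open) and effectively open (there are uniformly effective open $U_\sigma\subseteq X$ with $f([\sigma])=U_\sigma$). *)

theory Defs
  imports "HOL-Analysis.Analysis" "HOL-Library.Nat_Bijection"
begin

section \<open>Computability\<close>

text \<open>
  Partial recursive functions of one argument relative to \<open>p\<close> (the program \<open>PQuery\<close> looks up
  values of \<open>p\<close>); functions of several arguments are coded through the pairing bijection \<^const>\<open>prod_encode\<close>.
\<close>

datatype prog =
    PZero | PSucc | PFst | PSnd | PQuery
  | PPair prog prog | PComp prog prog | PRec prog prog | PMin prog

inductive evals :: "(nat \<Rightarrow> nat) \<Rightarrow> prog \<Rightarrow> nat \<Rightarrow> nat \<Rightarrow> bool" for p :: "nat \<Rightarrow> nat" where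
  zero: "evals p PZero x 0"
| succ: "evals p PSucc x (Suc x)"
| fst: "evals p PFst (prod_encode (a, b)) a"
| snd: "evals p PSnd (prod_encode (a, b)) b"
| query: "evals p PQuery x (p x)"
| pair: "evals p c x y \<Longrightarrow> evals p d x z \<Longrightarrow> evals p (PPair c d) x (prod_encode (y, z))"
| comp: "evals p d x y \<Longrightarrow> evals p c y z \<Longrightarrow> evals p (PComp c d) x z"
| rec_0: "evals p c a y \<Longrightarrow> evals p (PRec c d) (prod_encode (a, 0)) y"
| rec_Suc: "evals p (PRec c d) (prod_encode (a, n)) y
    \<Longrightarrow> evals p d (prod_encode (a, prod_encode (n, y))) z
    \<Longrightarrow> evals p (PRec c d) (prod_encode (a, Suc n)) z"
| min: "evals p c (prod_encode (x, n)) 0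
    \<Longrightarrow> (\<And>m. m < n \<Longrightarrow> \<exists>y. evals p c (prod_encode (x, m)) (Suc y))
    \<Longrightarrow> evals p (PMin c) x n"

primrec goedel :: "prog \<Rightarrow> nat" where
  "goedel PZero = 0"
| "goedel PSucc = 1"
| "goedel PFst = 2"
| "goedel PSnd = 3"
| "goedel PQuery = 4"
| "goedel (PPair c d) = 5 + 4 * prod_encode (goedel c, goedel d)"
| "goedel (PComp c d) = 6 + 4 * prod_encode (goedel c, goedel d)"
| "goedel (PRec c d) = 7 + 4 * prod_encode (goedel c, goedel d)"
| "goedel (PMin c) = 8 + 4 * goedel c"

lemma inj_goedel: "goedel c = goedel d \<Longrightarrow> c = d"
proof (induction c arbitrary: d)
  case PZero then show ?case by (cases d) auto
next
  case PSucc then show ?case by (cases d) auto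
next
  case PFst then show ?case by (cases d) auto
next
  case PSnd then show ?case by (cases d) auto
next
  case PQuery then show ?case by (cases d) auto
next
  case (PPair c1 c2) then show ?case by (cases d) (auto, presburger+)
next
  case (PComp c1 c2) then show ?case by (cases d) (auto, presburger+)
next
  case (PRec c1 c2) then show ?case by (cases d) (auto, presburger+)
next
  case (PMin c) then show ?case by (cases d) (auto, presburger+)
qed

lemma surj_goedel: "\<exists>c. goedel c = n"
proof (induction n rule: less_induct)
  case (less n)
  show ?case
  proof (cases "n < 5")
    case True
    then have "n = 0 \<or> n = 1 \<or> n = 2 \<or> n = 3 \<or> n = 4" by auto
    then show ?thesis using goedel.simps(1-5) by metis
  next
    case False
    define m where "m = (n - 5) div 4"
    obtain a b where ab: "m = prod_encode (a, b)"
      by (metis prod_decode_inverse surj_pair)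
    have "m < n" using False by (simp add: m_def)
    moreover have "a \<le> m" "b \<le> m" by (simp_all add: ab le_prod_encode_1 le_prod_encode_2)
    ultimately obtain c d e where cde: "goedel c = a" "goedel d = b" "goedel e = m"
      using less.IH by (meson le_less_trans)
    have "n = 5 + 4 * m \<or> n = 6 + 4 * m \<or> n = 7 + 4 * m \<or> n = 8 + 4 * m"
      using False unfolding m_def by presburger
    then show ?thesis
      using goedel.simps(6)[of c d] goedel.simps(7)[of c d] goedel.simps(8)[of c d]
        goedel.simps(9)[of e] cde ab by metis
  qed
qed

lemma bij_goedel: "bij goedel"
  by (meson bijI injI inj_goedel surjI surj_goedel surj_def)

text \<open>
  The unrelativized notions are those relative to the constant function 0.
\<close>

definition W :: "nat \<Rightarrow> nat set" where
  "W e = {x. \<exists>c y. goedel c = e \<and> evals (\<lambda>_. 0) c x y}"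

definition ce :: "nat set \<Rightarrow> bool" where
  "ce A \<longleftrightarrow> (\<exists>e. A = W e)"

definition computable :: "(nat \<Rightarrow> nat) \<Rightarrow> bool" where
  "computable f \<longleftrightarrow> (\<exists>c. \<forall>x. evals (\<lambda>_. 0) c x (f x))"

definition computable2 :: "(nat \<Rightarrow> nat \<Rightarrow> nat) \<Rightarrow> bool" where
  "computable2 f \<longleftrightarrow> (\<exists>c. \<forall>x y. evals (\<lambda>_. 0) c (prod_encode (x, y)) (f x y))"

text \<open>
  A partial function on Baire space is computable if a single program computes \<open>F p\<close> relative to \<open>p\<close>
  for every \<open>p\<close> in the domain of \<open>F\<close>. As usual in computable analysis, nothing is required of
  the program outside this domain, so restrictions of computable functions are computable.
\<close>

definition partial_computable :: "((nat \<Rightarrow> nat) \<rightharpoonup> (nat \<Rightarrow> nat)) \<Rightarrow> bool" where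
  "partial_computable F \<longleftrightarrow> (\<exists>c. \<forall>p q. F p = Some q \<longrightarrow> (\<forall>n. evals p c n (q n)))"

section \<open>Effective open sets\<close>

definition eff_open_set :: "(nat \<Rightarrow> 'a set) \<Rightarrow> nat \<Rightarrow> 'a set" where
  "eff_open_set B e = (\<Union>i\<in>W e. B i)"

definition uniformly_eff_open :: "(nat \<Rightarrow> 'a set) \<Rightarrow> (nat \<Rightarrow> 'a set) \<Rightarrow> bool" where
  "uniformly_eff_open B U \<longleftrightarrow> (\<exists>f. computable f \<and> (\<forall>n. U n = eff_open_set B (f n)))"

definition effective_topological_space :: "'a topology \<Rightarrow> (nat \<Rightarrow> 'a set) \<Rightarrow> bool" where
  "effective_topological_space X B \<longleftrightarrow>
     t0_space X \<and>
     (\<forall>i. openin X (B i)) \<and>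
     (\<forall>U x. openin X U \<and> x \<in> U \<longrightarrow> (\<exists>i. x \<in> B i \<and> B i \<subseteq> U)) \<and>
     (\<exists>f. computable2 f \<and> (\<forall>i j. B i \<inter> B j = eff_open_set B (f i j)))"

section \<open>Subsets of Baire space\<close>

definition cylinder :: "nat list \<Rightarrow> (nat \<Rightarrow> nat) set" where
  "cylinder \<sigma> = {p. \<forall>i<length \<sigma>. p i = \<sigma> ! i}"

definition baire_basis :: "nat \<Rightarrow> (nat \<Rightarrow> nat) set" where
  "baire_basis n = cylinder (list_decode n)"

definition Sigma02 :: "(nat \<Rightarrow> nat) set \<Rightarrow> bool" where
  "Sigma02 A \<longleftrightarrow> (\<exists>U V. uniformly_eff_open baire_basis U \<and> uniformly_eff_open baire_basis V \<and>
     A = (\<Union>n. U n - V n))"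

definition Pi02 :: "(nat \<Rightarrow> nat) set \<Rightarrow> bool" where
  "Pi02 A \<longleftrightarrow> Sigma02 (- A)"

definition computably_overt :: "(nat \<Rightarrow> nat) set \<Rightarrow> bool" where
  "computably_overt A \<longleftrightarrow> ce (list_encode ` {\<sigma>. cylinder \<sigma> \<inter> A \<noteq> {}})"

section \<open>Representations\<close>

definition canonical_embedding :: "(nat \<Rightarrow> 'a set) \<Rightarrow> 'a \<Rightarrow> nat set" where
  "canonical_embedding B x = {n. x \<in> B n}"

definition enumerated_set :: "(nat \<Rightarrow> nat) \<Rightarrow> nat set" where
  "enumerated_set p = {n. \<exists>i. p i = n + 1}"

definition standard_representation ::
  "'a topology \<Rightarrow> (nat \<Rightarrow> 'a set) \<Rightarrow> (nat \<Rightarrow> nat) \<rightharpoonup> 'a" where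
  "standard_representation X B p =
     (if enumerated_set p \<in> canonical_embedding B ` topspace X
      then Some (the_inv_into (topspace X) (canonical_embedding B) (enumerated_set p))
      else None)"

definition is_representation :: "'a topology \<Rightarrow> ((nat \<Rightarrow> nat) \<rightharpoonup> 'a) \<Rightarrow> bool" where
  "is_representation X \<delta> \<longleftrightarrow> ran \<delta> = topspace X"

definition computably_admissible ::
  "'a topology \<Rightarrow> (nat \<Rightarrow> 'a set) \<Rightarrow> ((nat \<Rightarrow> nat) \<rightharpoonup> 'a) \<Rightarrow> bool" where
  "computably_admissible X B \<delta> \<longleftrightarrow>
     (\<exists>F G. partial_computable F \<and> partial_computable G \<and>
        standard_representation X B = \<delta> \<circ>\<^sub>m F \<and>
        \<delta> = standard_representation X B \<circ>\<^sub>m G)"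

section \<open>Effective quasi-Polish spaces\<close>

definition effective_quasi_Polish :: "'a topology \<Rightarrow> (nat \<Rightarrow> 'a set) \<Rightarrow> bool" where
  "effective_quasi_Polish X B \<longleftrightarrow>
     topspace X = {} \<or>
     (\<exists>f :: (nat \<Rightarrow> nat) \<Rightarrow> 'a.
        range f = topspace X \<and>
        uniformly_eff_open baire_basis (\<lambda>i. f -` B i) \<and>
        uniformly_eff_open B (\<lambda>n. f ` cylinder (list_decode n)))"

end

theory Submission
  imports Defs "HOL-Library.Sublist" "HOL-Library.More_List"
begin

text \<open>
  The domain of the standard representation \<open>\<rho>\<close> of \<open>X\<close> inherits the hypotheses on \<open>dom \<delta>\<close>. It is
  \<open>\<Pi>\<^sup>0\<^sub>2\<close>, because \<open>p\<close> belongs to it iff translating \<open>p\<close> to a \<open>\<delta>\<close>-name and back succeeds, passes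
  through \<open>dom \<delta>\<close>, and enumerates the same set as \<open>p\<close>; it is computably overt, because \<open>[\<sigma>]\<close> meets
  it iff some \<open>\<delta>\<close>-name translates to an enumeration containing the indices listed by \<open>\<sigma>\<close>. A nonempty
  computably overt \<open>\<Pi>\<^sup>0\<^sub>2\<close> set is the image of Baire space under a computable, effectively open map \<open>g\<close>:
  the \<open>n\<close>-th input value selects an extension of the current finite sequence that still meets the set
  and meets the \<open>n\<close>-th open requirement, with a default found by search if the selection is invalid.
  Since \<open>\<rho>\<close> maps \<open>[\<sigma>]\<close> onto a finite intersection of basic open sets, \<open>\<rho> \<circ> g\<close> is computable and effectively open.
\<close>

section \<open>Computable functions and decidable predicates\<close>

abbreviation pfst :: "nat \<Rightarrow> nat" where "pfst n \<equiv> fst (prod_decode n)"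
abbreviation psnd :: "nat \<Rightarrow> nat" where "psnd n \<equiv> snd (prod_decode n)"

named_theorems computable_intros

lemma evals_fst: "evals p PFst x (pfst x)"
  by (metis evals.fst prod.collapse prod_decode_inverse)

lemma evals_snd: "evals p PSnd x (psnd x)"
  by (metis evals.snd prod.collapse prod_decode_inverse)

text \<open>There is no identity primitive; recombining the two projections gives one because every
  number codes a pair.\<close>

definition id_prog :: prog where "id_prog = PPair PFst PSnd"

lemma evals_id: "evals p id_prog x x"
  unfolding id_prog_def using evals.pair[OF evals_fst[of p x] evals_snd[of p x]] by simp

primrec const_prog :: "nat \<Rightarrow> prog" where
  "const_prog 0 = PZero"
| "const_prog (Suc n) = PComp PSucc (const_prog n)"

lemma evals_const: "evals p (const_prog n) x n"
  by (induction n) (auto intro: evals.intros)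

text \<open>Induction on the first evaluation, inverting the second. Only minimization compares two
  results: if they differed, the smaller would be a zero in one evaluation and have a successor
  value in the other.\<close>

lemma evals_functional: "evals p c x y \<Longrightarrow> evals p c x z \<Longrightarrow> y = z"
proof (induction arbitrary: z rule: evals.induct)
  case (comp d x y c w)
  from comp.prems show ?case by cases (use comp.IH in blast)
next
  case (pair c x y d w)
  from pair.prems show ?case by cases (use pair.IH in blast)
next
  case (rec_0 c a y d)
  from rec_0.prems show ?case by cases (use rec_0.IH in \<open>auto\<close>)
next
  case (rec_Suc c d a n y w)
  from rec_Suc.prems show ?case by cases (use rec_Suc.IH in \<open>auto\<close>)
next
  case (min c x n)
  from min.prems show ?case
  proof cases
    case min': min
    show ?thesis
    proof (rule linorder_cases[of n z])
      assume "n < z"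
      then show ?thesis using min'(2) min.IH(1) by (metis nat.distinct(1))
    next
      assume "z < n"
      then show ?thesis using min'(1) min.IH(2) by (metis nat.distinct(1))
    qed
  qed
qed (auto elim: evals.cases)

lemma computable_id [computable_intros]: "computable (\<lambda>x. x)"
  unfolding computable_def using evals_id by blast

lemma computable_const [computable_intros]: "computable (\<lambda>x. k)"
  unfolding computable_def using evals_const by blast

lemma computable_compose: "computable f \<Longrightarrow> computable g \<Longrightarrow> computable (\<lambda>x. f (g x))"
  unfolding computable_def by (meson evals.comp)

lemma computable_fst [computable_intros]: "computable f \<Longrightarrow> computable (\<lambda>x. pfst (f x))"
  by (rule computable_compose[of pfst]) (use evals_fst computable_def in blast)

lemma computable_snd [computable_intros]: "computable f \<Longrightarrow> computable (\<lambda>x. psnd (f x))"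
  by (rule computable_compose[of psnd]) (use evals_snd computable_def in blast)

lemma computable_Suc [computable_intros]: "computable f \<Longrightarrow> computable (\<lambda>x. Suc (f x))"
  by (rule computable_compose[of Suc]) (use evals.succ computable_def in blast)

lemma computable_pair [computable_intros]:
  "computable f \<Longrightarrow> computable g \<Longrightarrow> computable (\<lambda>x. prod_encode (f x, g x))"
  unfolding computable_def by (meson evals.pair)

lemma computable_compose2:
  assumes "computable2 h" "computable f" "computable g"
  shows "computable (\<lambda>x. h (f x) (g x))"
proof -
  have "computable (\<lambda>z. h (pfst z) (psnd z))"
    using assms(1) unfolding computable_def computable2_def
    by (metis prod.collapse prod_decode_inverse)
  from computable_compose[OF this computable_pair[OF assms(2,3)]] show ?thesis by simp
qed

text \<open>The whole input \<open>x\<close> serves as the parameter of \<open>PRec\<close>, so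
  start value, step and bound may all depend on it.\<close>

lemma computable_rec_nat [computable_intros]:
  assumes "computable f" "computable (\<lambda>z. h (pfst z) (pfst (psnd z)) (psnd (psnd z)))" "computable k"
  shows "computable (\<lambda>x. rec_nat (f x) (h x) (k x))"
proof -
  let ?o = "\<lambda>_. 0 :: nat"
  obtain cf ch ck where c: "\<And>x. evals ?o cf x (f x)" "\<And>x. evals ?o ck x (k x)"
    "\<And>z. evals ?o ch z (h (pfst z) (pfst (psnd z)) (psnd (psnd z)))"
    using assms unfolding computable_def by auto
  have step: "evals ?o ch (prod_encode (x, prod_encode (n, y))) (h x n y)" for x n y
    using c(3)[of "prod_encode (x, prod_encode (n, y))"] by simp
  have "evals ?o (PRec cf ch) (prod_encode (x, n)) (rec_nat (f x) (h x) n)" for x n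
    by (induction n) (auto intro: evals.intros c step)
  then have "evals ?o (PComp (PRec cf ch) (PPair id_prog ck)) x (rec_nat (f x) (h x) (k x))" for x
    by (rule evals.comp[OF evals.pair[OF evals_id c(2)]])
  then show ?thesis unfolding computable_def by blast
qed

lemma computable_add [computable_intros]:
  assumes "computable f" "computable g" shows "computable (\<lambda>x. f x + g x)"
proof -
  have "rec_nat a (\<lambda>n y. Suc y) b = a + b" for a b :: nat by (induction b) auto
  moreover have "computable (\<lambda>x. rec_nat (f x) (\<lambda>n y. Suc y) (g x))"
    by (intro computable_intros assms)
  ultimately show ?thesis by simp
qed

lemma computable_mult [computable_intros]:
  assumes "computable f" "computable g" shows "computable (\<lambda>x. f x * g x)"
proof -
  have "rec_nat 0 (\<lambda>n y. y + a) b = a * b" for a b :: nat by (induction b) auto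
  moreover have "computable (\<lambda>x. rec_nat 0 (\<lambda>n y. y + f x) (g x))"
    by (intro computable_intros computable_compose[OF assms(1)] assms)
  ultimately show ?thesis by simp
qed

lemma computable_diff [computable_intros]:
  assumes "computable f" "computable g" shows "computable (\<lambda>x. f x - g x)"
proof -
  \<comment> \<open>Predecessor is the recursion that returns the previous index and ignores the
    accumulated value; truncated subtraction iterates it.\<close>
  have "rec_nat 0 (\<lambda>n y. n) b = b - 1" for b by (cases b) auto
  moreover have "computable (rec_nat 0 (\<lambda>n y. n))"
    using computable_rec_nat[of "\<lambda>_. 0" "\<lambda>x n y. n" "\<lambda>x. x"] by (simp add: computable_intros)
  ultimately have pred: "computable (\<lambda>b. b - 1)" by (metis (no_types, lifting) ext)
  have "rec_nat a (\<lambda>n y. y - 1) b = a - b" for a b :: nat by (induction b) auto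
  moreover have "computable (\<lambda>x. rec_nat (f x) (\<lambda>n y. y - 1) (g x))"
    by (intro computable_intros computable_compose[OF pred] assms)
  ultimately show ?thesis by simp
qed

section \<open>Decidable predicates, bounded quantifiers and unbounded search\<close>

definition decidable :: "(nat \<Rightarrow> bool) \<Rightarrow> bool" where
  "decidable P \<longleftrightarrow> computable (\<lambda>x. of_bool (P x))"

lemma decidable_compose: "decidable P \<Longrightarrow> computable f \<Longrightarrow> decidable (\<lambda>x. P (f x))"
  unfolding decidable_def by (rule computable_compose)

lemma decidable_const [computable_intros]: "decidable (\<lambda>x. b)"
  unfolding decidable_def by (rule computable_const)

lemma decidable_le [computable_intros]:
  assumes "computable f" "computable g" shows "decidable (\<lambda>x. f x \<le> g x)"
proof -
  have "of_bool (f x \<le> g x) = 1 - (f x - g x)" for x by simp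
  then show ?thesis unfolding decidable_def by (simp only:) (intro computable_intros assms)
qed

lemma decidable_not [computable_intros]:
  assumes "decidable P" shows "decidable (\<lambda>x. \<not> P x)"
proof -
  have "of_bool (\<not> P x) = (1 :: nat) - of_bool (P x)" for x by simp
  then show ?thesis using assms unfolding decidable_def by (simp only:) (intro computable_intros)
qed

lemma decidable_conj [computable_intros]:
  assumes "decidable P" "decidable Q" shows "decidable (\<lambda>x. P x \<and> Q x)"
  using assms unfolding decidable_def of_bool_conj by (intro computable_intros)

lemma decidable_disj [computable_intros]:
  assumes "decidable P" "decidable Q" shows "decidable (\<lambda>x. P x \<or> Q x)"
proof -
  have "decidable (\<lambda>x. \<not> (\<not> P x \<and> \<not> Q x))" by (intro computable_intros assms)
  then show ?thesis by simp
qed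

lemma decidable_less [computable_intros]:
  assumes "computable f" "computable g" shows "decidable (\<lambda>x. f x < g x)"
  unfolding less_eq_Suc_le by (intro computable_intros assms)

lemma decidable_eq [computable_intros]:
  assumes "computable f" "computable g" shows "decidable (\<lambda>x. f x = g x)"
  unfolding order.eq_iff by (intro computable_intros assms)

lemma decidable_bex [computable_intros]:
  assumes "computable f" "decidable (\<lambda>z. P (pfst z) (psnd z))"
  shows "decidable (\<lambda>x. \<exists>k<f x. P x k)"
proof -
  \<comment> \<open>The truncated difference \<open>1 - (1 - a)\<close> sends every positive
    \<open>a\<close> to 1, so the recursion accumulates a disjunction.\<close>
  have "rec_nat 0 (\<lambda>k y. 1 - (1 - (y + of_bool (P x k)))) n = (of_bool (\<exists>k<n. P x k) :: nat)" for x n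
    by (induction n) (auto simp: less_Suc_eq)
  moreover have "computable (\<lambda>x. rec_nat 0 (\<lambda>k y. 1 - (1 - (y + of_bool (P x k)))) (f x))"
    using decidable_compose[OF assms(2), of "\<lambda>z. prod_encode (pfst z, pfst (psnd z))"]
    by (intro computable_intros assms) (simp_all add: decidable_def computable_intros)
  ultimately show ?thesis unfolding decidable_def by simp
qed

lemma decidable_ball [computable_intros]:
  assumes "computable f" "decidable (\<lambda>z. P (pfst z) (psnd z))"
  shows "decidable (\<lambda>x. \<forall>k<f x. P x k)"
proof -
  have "decidable (\<lambda>x. \<not> (\<exists>k<f x. \<not> P x k))" by (intro computable_intros assms)
  then show ?thesis by simp
qed

text \<open>\<open>PMin\<close> looks for a first zero, hence it is applied to the characteristic
  function of the negation of \<open>R\<close>. The equivalence also covers divergence, when no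
  \<open>y\<close> satisfies \<open>R\<close>.\<close>

lemma evals_min_decidable:
  assumes "decidable R"
  obtains c where "\<And>x y. evals (\<lambda>_. 0) c x y \<longleftrightarrow>
    R (prod_encode (x, y)) \<and> (\<forall>m<y. \<not> R (prod_encode (x, m)))"
proof -
  let ?o = "\<lambda>_. 0 :: nat"
  have "computable (\<lambda>x. of_bool (\<not> R x))"
    using decidable_not[OF assms] unfolding decidable_def .
  then obtain c where c: "\<And>x. evals ?o c x (of_bool (\<not> R x))" unfolding computable_def by blast
  have iff: "evals ?o c x y \<longleftrightarrow> y = of_bool (\<not> R x)" for x y
    using c evals_functional by blast
  show ?thesis
  proof (rule that[of "PMin c"])
    fix x y
    show "evals ?o (PMin c) x y \<longleftrightarrow> R (prod_encode (x, y)) \<and> (\<forall>m<y. \<not> R (prod_encode (x, m)))"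
    proof
      assume "evals ?o (PMin c) x y"
      then show "R (prod_encode (x, y)) \<and> (\<forall>m<y. \<not> R (prod_encode (x, m)))"
        by cases (auto simp: iff, metis (full_types) of_bool_eq(1) nat.distinct(1))
    next
      assume "R (prod_encode (x, y)) \<and> (\<forall>m<y. \<not> R (prod_encode (x, m)))"
      then show "evals ?o (PMin c) x y"
        by (intro evals.min) (auto simp: iff)
    qed
  qed
qed

text \<open>Searching the graph for the value terminates because \<open>f\<close> is total. This
  serves functions whose values are easier to check than to build.\<close>

lemma computable_if_decidable_graph:
  assumes "decidable (\<lambda>z. psnd z = f (pfst z))"
  shows "computable f"
proof -
  obtain c where "\<And>x y. evals (\<lambda>_. 0) c x y \<longleftrightarrow> y = f x \<and> (\<forall>m<y. m \<noteq> f x)"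
    using evals_min_decidable[OF assms] by (metis prod_encode_inverse fst_conv snd_conv)
  then show ?thesis unfolding computable_def by (metis less_irrefl)
qed

section \<open>Finite sequences\<close>

text \<open>Dropping iterates the tail, so it is primitive recursive on codes; access to entries and
  the length are derived from it.\<close>

definition drop_code :: "nat \<Rightarrow> nat \<Rightarrow> nat" where
  "drop_code n c = list_encode (drop n (list_decode c))"

lemma list_decode_drop_code [simp]: "list_decode (drop_code n c) = drop n (list_decode c)"
  by (simp add: drop_code_def)

lemma prod_decode_0: "prod_decode 0 = (0, 0)"
proof -
  have "prod_encode (0, 0) = 0" by (simp add: prod_encode_def)
  then show ?thesis by (metis prod_encode_inverse)
qed

text \<open>A nonempty list is coded by the successor of a pair of head and tail code. The empty
  list, with code 0, fits in because 0 also codes the pair \<open>(0, 0)\<close>.\<close>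

lemma tl_code: "list_encode (tl (list_decode c)) = psnd (c - 1)"
  by (cases c) (auto simp: prod_decode_0 split: prod.split)

lemma hd_code: "nth_default 0 (list_decode c) 0 = pfst (c - 1)"
  by (cases c) (auto simp: prod_decode_0 nth_default_def split: prod.split)

lemma computable_drop_code [computable_intros]:
  assumes "computable f" "computable g" shows "computable (\<lambda>x. drop_code (f x) (g x))"
proof -
  have "rec_nat c (\<lambda>_ y. psnd (y - 1)) n = drop_code n c" for c n
  proof (induction n)
    case (Suc n)
    then show ?case
      using tl_code[of "drop_code n c"] by (simp add: drop_code_def drop_Suc tl_drop)
  qed (simp add: drop_code_def)
  moreover have "computable (\<lambda>x. rec_nat (g x) (\<lambda>_ y. psnd (y - 1)) (f x))"
    by (intro computable_intros assms)
  ultimately show ?thesis by simp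
qed

lemma computable_nth [computable_intros]:
  assumes "computable f" "computable g"
  shows "computable (\<lambda>x. nth_default 0 (list_decode (f x)) (g x))"
proof -
  have "nth_default 0 (list_decode c) n = pfst (drop_code n c - 1)" for c n
    using hd_code[of "drop_code n c"] by (auto simp: nth_default_def split: if_splits)
  then show ?thesis by (simp only:) (intro computable_intros assms)
qed

text \<open>The length is the least number of entries whose removal leaves 0, the code of the empty
  list; this makes its graph decidable.\<close>

lemma computable_length [computable_intros]:
  assumes "computable f" shows "computable (\<lambda>x. length (list_decode (f x)))"
proof -
  have "drop_code n c = 0 \<longleftrightarrow> length (list_decode c) \<le> n" for n c
    by (metis drop_code_def drop_eq_Nil list_decode_drop_code list_decode.simps(1) list_encode.simps(1))
  moreover have "(\<forall>k<n. \<not> m \<le> k) \<longleftrightarrow> n \<le> m" for n m :: nat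
    by (meson leI le_trans less_irrefl not_less)
  ultimately have "n = length (list_decode c) \<longleftrightarrow>
      drop_code n c = 0 \<and> (\<forall>k<n. drop_code k c \<noteq> 0)" for n c
    by auto
  then have "decidable (\<lambda>z. psnd z = length (list_decode (pfst z)))"
    by (simp only:) (intro computable_intros)
  from computable_compose[OF computable_if_decidable_graph[OF this] assms] show ?thesis .
qed

lemma decidable_mem [computable_intros]:
  assumes "computable f" "computable g" shows "decidable (\<lambda>x. f x \<in> set (list_decode (g x)))"
proof -
  have "v \<in> set l \<longleftrightarrow> (\<exists>i<length l. nth_default 0 l i = v)" for v :: nat and l
    by (auto simp: in_set_conv_nth nth_default_def)
  then show ?thesis
    by (simp only:) (intro computable_intros computable_compose[OF assms(1)] computable_compose[OF assms(2)] assms)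
qed

text \<open>Access by \<open>nth_default\<close> is total and computable; the length bounds keep the
  default 0 from being mistaken for an entry.\<close>

lemma prefix_iff_nth_default:
  "prefix s t \<longleftrightarrow> length s \<le> length t \<and> (\<forall>i<length s. nth_default 0 s i = nth_default 0 t i)"
proof
  assume "prefix s t"
  then show "length s \<le> length t \<and> (\<forall>i<length s. nth_default 0 s i = nth_default 0 t i)"
    by (auto simp: prefix_def nth_default_def nth_append)
next
  assume *: "length s \<le> length t \<and> (\<forall>i<length s. nth_default 0 s i = nth_default 0 t i)"
  then have "take (length s) t = s" by (intro nth_equalityI) (auto simp: nth_default_def)
  then show "prefix s t" by (metis take_is_prefix)
qed

lemma decidable_prefix [computable_intros]:
  assumes "computable f" "computable g"
  shows "decidable (\<lambda>x. prefix (list_decode (f x)) (list_decode (g x)))"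
  unfolding prefix_iff_nth_default
  by (intro computable_intros computable_compose[OF assms(1)] computable_compose[OF assms(2)] assms)

section \<open>Semidecidable predicates\<close>

text \<open>The existential form reduces closure properties to decidable predicates and pairing of
  witnesses; the link with \<open>W\<close> is made by the enumeration theorem.\<close>

definition semidecidable :: "(nat \<Rightarrow> bool) \<Rightarrow> bool" where
  "semidecidable P \<longleftrightarrow> (\<exists>R. decidable R \<and> (\<forall>x. P x \<longleftrightarrow> (\<exists>w. R (prod_encode (x, w)))))"

named_theorems semidecidable_intros

lemma semidecidableI:
  assumes "decidable (\<lambda>z. R (pfst z) (psnd z))" "\<And>x. P x \<longleftrightarrow> (\<exists>w. R x w)"
  shows "semidecidable P"
  unfolding semidecidable_def 
  by (intro exI[of _ "\<lambda>z. R (pfst z) (psnd z)"]) (simp add: assms)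

lemma semidecidableE:
  assumes "semidecidable P"
  obtains R where "decidable R" "\<And>x. P x \<longleftrightarrow> (\<exists>w. R (prod_encode (x, w)))"
  using assms unfolding semidecidable_def by blast

lemma semidecidable_decidable: "decidable P \<Longrightarrow> semidecidable P"
  by (rule semidecidableI[of "\<lambda>x w. P x"])
    (auto intro: decidable_compose[OF _ computable_fst[OF computable_id]])

lemma semidecidable_compose:
  assumes "semidecidable P" "computable f" shows "semidecidable (\<lambda>x. P (f x))"
proof -
  obtain R where R: "decidable R" "\<And>x. P x \<longleftrightarrow> (\<exists>w. R (prod_encode (x, w)))"
    using assms(1) by (rule semidecidableE) blast
  show ?thesis
  proof (rule semidecidableI[of "\<lambda>x w. R (prod_encode (f x, w))"])
    show "decidable (\<lambda>z. R (prod_encode (f (pfst z), psnd z)))"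
      by (intro decidable_compose[OF R(1)] computable_compose[OF assms(2)] computable_intros)
  qed (rule R(2))
qed

lemma semidecidable_compose2:
  assumes "semidecidable (\<lambda>z. P (pfst z) (psnd z))" "computable f" "computable g"
  shows "semidecidable (\<lambda>x. P (f x) (g x))"
  using semidecidable_compose[OF assms(1) computable_pair[OF assms(2,3)]] by simp

lemma semidecidable_conj [semidecidable_intros]:
  assumes "semidecidable P" "semidecidable Q" shows "semidecidable (\<lambda>x. P x \<and> Q x)"
proof -
  obtain R where R: "decidable R" "\<And>x. P x \<longleftrightarrow> (\<exists>w. R (prod_encode (x, w)))"
    using assms(1) by (rule semidecidableE) blast
  obtain S where S: "decidable S" "\<And>x. Q x \<longleftrightarrow> (\<exists>w. S (prod_encode (x, w)))"
    using assms(2) by (rule semidecidableE) blast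
  show ?thesis
  proof (rule semidecidableI[of "\<lambda>x w. R (prod_encode (x, pfst w)) \<and> S (prod_encode (x, psnd w))"])
    show "decidable (\<lambda>z. R (prod_encode (pfst z, pfst (psnd z))) \<and> S (prod_encode (pfst z, psnd (psnd z))))"
      by (intro computable_intros decidable_compose[OF R(1)] decidable_compose[OF S(1)])
    show "P x \<and> Q x \<longleftrightarrow> (\<exists>w. R (prod_encode (x, pfst w)) \<and> S (prod_encode (x, psnd w)))" for x
      unfolding R(2) S(2) by (metis prod_encode_inverse fst_conv snd_conv)
  qed
qed

lemma semidecidable_disj [semidecidable_intros]:
  assumes "semidecidable P" "semidecidable Q" shows "semidecidable (\<lambda>x. P x \<or> Q x)"
proof -
  obtain R where R: "decidable R" "\<And>x. P x \<longleftrightarrow> (\<exists>w. R (prod_encode (x, w)))"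
    using assms(1) by (rule semidecidableE) blast
  obtain S where S: "decidable S" "\<And>x. Q x \<longleftrightarrow> (\<exists>w. S (prod_encode (x, w)))"
    using assms(2) by (rule semidecidableE) blast
  have "decidable (\<lambda>z. R z \<or> S z)" by (intro computable_intros R S)
  then show ?thesis unfolding semidecidable_def R(2) S(2) by blast
qed

lemma semidecidable_ex [semidecidable_intros]:
  assumes "semidecidable (\<lambda>z. P (pfst z) (psnd z))" shows "semidecidable (\<lambda>x. \<exists>y. P x y)"
proof -
  obtain R where R: "decidable R" "\<And>z. P (pfst z) (psnd z) \<longleftrightarrow> (\<exists>w. R (prod_encode (z, w)))"
    using assms by (rule semidecidableE) blast
  have R2: "P x y \<longleftrightarrow> (\<exists>w. R (prod_encode (prod_encode (x, y), w)))" for x y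
    using R(2)[of "prod_encode (x, y)"] by simp
  show ?thesis
  proof (rule semidecidableI[of "\<lambda>x w. R (prod_encode (prod_encode (x, pfst w), psnd w))"])
    show "decidable (\<lambda>z. R (prod_encode (prod_encode (pfst z, pfst (psnd z)), psnd (psnd z))))"
      by (intro computable_intros decidable_compose[OF R(1)])
    show "(\<exists>y. P x y) \<longleftrightarrow> (\<exists>w. R (prod_encode (prod_encode (x, pfst w), psnd w)))" for x
      unfolding R2 by (metis prod_encode_inverse fst_conv snd_conv)
  qed
qed

lemma semidecidable_ex_list [semidecidable_intros]:
  assumes "semidecidable (\<lambda>z. P (pfst z) (list_decode (psnd z)))"
  shows "semidecidable (\<lambda>x. \<exists>l. P x l)"
proof -
  have "(\<exists>l. P x l) \<longleftrightarrow> (\<exists>c. P x (list_decode c))" for x by (metis list_encode_inverse)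
  then show ?thesis using semidecidable_ex[of "\<lambda>x c. P x (list_decode c)"] assms by simp
qed

text \<open>Finitely many witnesses have a common bound \<open>b\<close>. Moving \<open>b\<close> to
  the front leaves only bounded quantifiers, which are decidable.\<close>

lemma semidecidable_ball [semidecidable_intros]:
  assumes "computable f" "semidecidable (\<lambda>z. P (pfst z) (psnd z))"
  shows "semidecidable (\<lambda>x. \<forall>k<f x. P x k)"
proof -
  obtain R where R: "decidable R" "\<And>z. P (pfst z) (psnd z) \<longleftrightarrow> (\<exists>w. R (prod_encode (z, w)))"
    using assms(2) by (rule semidecidableE) blast
  define S where "S x k w \<longleftrightarrow> R (prod_encode (prod_encode (x, k), w))" for x k w
  have S: "P x k \<longleftrightarrow> (\<exists>w. S x k w)" for x k
    using R(2)[of "prod_encode (x, k)"] by (simp add: S_def)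
  have bound: "(\<forall>k<n. P x k) \<longleftrightarrow> (\<exists>b. \<forall>k<n. \<exists>w<b. S x k w)" for x n
  proof (induction n)
    case (Suc n)
    show ?case
    proof
      assume *: "\<forall>k<Suc n. P x k"
      then obtain b where b: "\<forall>k<n. \<exists>w<b. S x k w" using Suc by auto
      obtain v where v: "S x n v" using * S by blast
      have "\<forall>k<Suc n. \<exists>w<max b (Suc v). S x k w"
        using b v by (metis less_Suc_eq less_max_iff_disj lessI)
      then show "\<exists>b. \<forall>k<Suc n. \<exists>w<b. S x k w" by blast
    qed (use S in blast)
  qed auto
  show ?thesis
  proof (rule semidecidableI[of "\<lambda>x b. \<forall>k<f x. \<exists>w<b. S x k w"])
    show "decidable (\<lambda>z. \<forall>k<f (pfst z). \<exists>w<psnd z. S (pfst z) k w)"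
      unfolding S_def
      by (intro computable_intros decidable_compose[OF R(1)] computable_compose[OF assms(1)])
  qed (rule bound)
qed

section \<open>The enumeration theorem\<close>

abbreviation triple :: "nat \<Rightarrow> nat \<Rightarrow> nat \<Rightarrow> nat" where
  "triple e x y \<equiv> prod_encode (e, prod_encode (x, y))"

text \<open>One disjunct per rule of \<open>evals\<close>, with codes in place of programs and
  premises looked up in the finite list \<open>D\<close>. Only the query clause consults
  \<open>Q\<close>.\<close>

definition justified ::
  "(nat \<Rightarrow> nat \<Rightarrow> bool) \<Rightarrow> nat list \<Rightarrow> nat \<Rightarrow> nat \<Rightarrow> nat \<Rightarrow> bool" where
  "justified Q D e x y \<longleftrightarrow>
     (e = 0 \<and> y = 0) \<or> (e = 1 \<and> y = Suc x) \<or> (e = 2 \<and> y = pfst x) \<or> (e = 3 \<and> y = psnd x) \<or>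
     (e = 4 \<and> Q x y) \<or>
     (\<exists>c d. e = 5 + 4 * prod_encode (c, d) \<and> triple c x (pfst y) \<in> set D \<and> triple d x (psnd y) \<in> set D) \<or>
     (\<exists>c d z. e = 6 + 4 * prod_encode (c, d) \<and> triple d x z \<in> set D \<and> triple c z y \<in> set D) \<or>
     (\<exists>c d. e = 7 + 4 * prod_encode (c, d) \<and> psnd x = 0 \<and> triple c (pfst x) y \<in> set D) \<or>
     (\<exists>c d n z. e = 7 + 4 * prod_encode (c, d) \<and> psnd x = Suc n \<and>
        triple e (prod_encode (pfst x, n)) z \<in> set D \<and>
        triple d (triple (pfst x) n z) y \<in> set D) \<or>
     (\<exists>c. e = 8 + 4 * c \<and> triple c (prod_encode (x, y)) 0 \<in> set D \<and>
        (\<forall>m<y. \<exists>z. triple c (prod_encode (x, m)) (Suc z) \<in> set D))"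

text \<open>Each entry is justified by later entries only, which excludes circular justifications
  and lets a new conclusion be added by consing.\<close>

definition derivation :: "(nat \<Rightarrow> nat \<Rightarrow> bool) \<Rightarrow> nat list \<Rightarrow> bool" where
  "derivation Q D \<longleftrightarrow> (\<forall>k<length D. justified Q (drop (Suc k) D) (pfst (nth_default 0 D k))
     (pfst (psnd (nth_default 0 D k))) (psnd (psnd (nth_default 0 D k))))"

text \<open>
  Evaluation with the oracle given by a relation: finite oracle information is the relation
  given by a finite sequence, so that the use principle becomes monotonicity in the relation.
\<close>

definition derivable :: "(nat \<Rightarrow> nat \<Rightarrow> bool) \<Rightarrow> nat \<Rightarrow> nat \<Rightarrow> nat \<Rightarrow> bool" where
  "derivable Q e x y \<longleftrightarrow> (\<exists>D. derivation Q D \<and> triple e x y \<in> set D)"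

lemma derivation_Nil [simp]: "derivation Q []"
  by (simp add: derivation_def)

lemma derivation_Cons:
  "derivation Q (t # D) \<longleftrightarrow> justified Q D (pfst t) (pfst (psnd t)) (psnd (psnd t)) \<and> derivation Q D"
  unfolding derivation_def length_Cons All_less_Suc2 by simp

text \<open>\<open>Q\<close> and the members of \<open>D\<close> occur only positively.\<close>

lemma justified_mono:
  assumes "justified Q D e x y" "\<And>u v. Q u v \<Longrightarrow> Q' u v" "set D \<subseteq> set D'"
  shows "justified Q' D' e x y"
  using assms(1) unfolding justified_def
  by (elim disj_forward conj_forward ex_forward all_forward imp_forward) (use assms(2,3) in auto)

lemma derivation_mono: "derivation Q D \<Longrightarrow> (\<And>u v. Q u v \<Longrightarrow> Q' u v) \<Longrightarrow> derivation Q' D"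
  unfolding derivation_def using justified_mono by blast

lemma derivable_mono: "derivable Q e x y \<Longrightarrow> (\<And>u v. Q u v \<Longrightarrow> Q' u v) \<Longrightarrow> derivable Q' e x y"
  unfolding derivable_def using derivation_mono by blast

text \<open>Entries of \<open>D\<close> are now justified over a longer remainder, which
  monotonicity permits. This merges the derivations of several premises.\<close>

lemma derivation_append: "derivation Q D \<Longrightarrow> derivation Q E \<Longrightarrow> derivation Q (D @ E)"
  by (induction D) (auto simp: derivation_Cons intro: justified_mono)

definition prog_of :: "nat \<Rightarrow> prog" where "prog_of = inv goedel"

lemma goedel_prog_of [simp]: "goedel (prog_of e) = e"
  by (simp add: prog_of_def surj_f_inv_f bij_goedel bij_is_surj)

lemma prog_of_goedel [simp]: "prog_of (goedel c) = c"
  by (simp add: inj_goedel)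

lemma prog_of_simps:
  "prog_of 0 = PZero" "prog_of 1 = PSucc" "prog_of 2 = PFst" "prog_of 3 = PSnd" "prog_of 4 = PQuery"
  "prog_of (5 + 4 * prod_encode (c, d)) = PPair (prog_of c) (prog_of d)"
  "prog_of (6 + 4 * prod_encode (c, d)) = PComp (prog_of c) (prog_of d)"
  "prog_of (7 + 4 * prod_encode (c, d)) = PRec (prog_of c) (prog_of d)"
  "prog_of (8 + 4 * c) = PMin (prog_of c)"
  by (rule inj_goedel, simp)+

text \<open>\<open>Q\<close> need only be contained in the graph of \<open>p\<close>, so finite
  oracle information is covered.\<close>

lemma justified_sound:
  assumes Q: "\<And>u v. Q u v \<Longrightarrow> v = p u"
    and D: "\<And>e x y. triple e x y \<in> set D \<Longrightarrow> evals p (prog_of e) x y"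
    and "justified Q D e x y"
  shows "evals p (prog_of e) x y"
  using assms(3) unfolding justified_def
proof (elim disjE exE conjE)
  fix c d assume "e = 5 + 4 * prod_encode (c, d)"
    "triple c x (pfst y) \<in> set D" "triple d x (psnd y) \<in> set D"
  then show ?thesis using evals.pair[OF D D, of c x "pfst y" d "psnd y"] by (simp add: prog_of_simps)
next
  fix c d assume *: "e = 7 + 4 * prod_encode (c, d)" "psnd x = 0" "triple c (pfst x) y \<in> set D"
  have "x = prod_encode (pfst x, 0)" by (metis *(2) prod.collapse prod_decode_inverse)
  with * show ?thesis using evals.rec_0[OF D] by (metis prog_of_simps(8))
next
  fix c d n z assume *: "e = 7 + 4 * prod_encode (c, d)" "psnd x = Suc n"
    "triple e (prod_encode (pfst x, n)) z \<in> set D" "triple d (triple (pfst x) n z) y \<in> set D"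
  have "x = prod_encode (pfst x, Suc n)" by (metis *(2) prod.collapse prod_decode_inverse)
  with * show ?thesis using evals.rec_Suc[OF _ D] D by (metis prog_of_simps(8))
next
  fix c assume *: "e = 8 + 4 * c" "triple c (prod_encode (x, y)) 0 \<in> set D"
    "\<forall>m<y. \<exists>z. triple c (prod_encode (x, m)) (Suc z) \<in> set D"
  show ?thesis unfolding *(1) prog_of_simps by (rule evals.min) (use * D in blast)+
next
  fix c d z assume "e = 6 + 4 * prod_encode (c, d)" "triple d x z \<in> set D" "triple c z y \<in> set D"
  then show ?thesis using evals.comp[OF D D, of d x z c y] by (simp add: prog_of_simps)
qed (use Q in \<open>auto simp: prog_of_simps prog_of_simps[simplified] intro: evals.intros evals_fst evals_snd\<close>)

lemma derivation_sound:
  assumes "\<And>u v. Q u v \<Longrightarrow> v = p u" "derivation Q D" "triple e x y \<in> set D"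
  shows "evals p (prog_of e) x y"
  using assms(2,3)
proof (induction D arbitrary: e x y)
  case (Cons t D)
  then show ?case
    using justified_sound[of Q p D, OF assms(1)] by (auto simp: derivation_Cons)
qed simp

lemma derivableI:
  assumes "derivation Q D" "justified Q D e x y" shows "derivable Q e x y"
  unfolding derivable_def using assms
  by (intro exI[of _ "triple e x y # D"]) (simp add: derivation_Cons)

text \<open>Serves minimization, which has one premise for each smaller candidate.\<close>

lemma derivable_finite:
  fixes n :: nat
  assumes "\<And>k. k < n \<Longrightarrow> derivable Q (e k) (x k) (y k)"
  shows "\<exists>D. derivation Q D \<and> (\<forall>k<n. triple (e k) (x k) (y k) \<in> set D)"
  using assms
proof (induction n)
  case (Suc n)
  then obtain D where D: "derivation Q D" "\<forall>k<n. triple (e k) (x k) (y k) \<in> set D" by auto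
  from Suc.prems[of n] obtain E where E: "derivation Q E" "triple (e n) (x n) (y n) \<in> set E"
    unfolding derivable_def by auto
  show ?case
    using derivation_append[OF D(1) E(1)] D(2) E(2)
    by (intro exI[of _ "D @ E"]) (auto simp: less_Suc_eq)
qed (auto intro: exI[of _ "[]"])

lemma derivable_two:
  assumes "derivable Q e x y" "derivable Q e' x' y'"
  obtains D where "derivation Q D" "triple e x y \<in> set D" "triple e' x' y' \<in> set D"
  using assms unfolding derivable_def by (metis UnCI derivation_append set_append)

lemma evals_derivable: "evals p c x y \<Longrightarrow> derivable (\<lambda>u v. v = p u) (goedel c) x y"
proof (induction rule: evals.induct)
  case (pair c x y d z)
  then obtain D where "derivation (\<lambda>u v. v = p u) D" "triple (goedel c) x y \<in> set D"
    "triple (goedel d) x z \<in> set D" using derivable_two by blast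
  then show ?case by (intro derivableI[of _ D]) (auto simp: justified_def)
next
  case (comp d x y c z)
  then obtain D where "derivation (\<lambda>u v. v = p u) D" "triple (goedel d) x y \<in> set D"
    "triple (goedel c) y z \<in> set D" using derivable_two by blast
  then show ?case by (intro derivableI[of _ D]) (auto simp: justified_def)
next
  case (rec_0 c a y d)
  then obtain D where "derivation (\<lambda>u v. v = p u) D" "triple (goedel c) a y \<in> set D"
    unfolding derivable_def by blast
  then show ?case by (intro derivableI[of _ D]) (auto simp: justified_def)
next
  case (rec_Suc c d a n y z)
  then obtain D where "derivation (\<lambda>u v. v = p u) D"
    "triple (goedel (PRec c d)) (prod_encode (a, n)) y \<in> set D"
    "triple (goedel d) (triple a n y) z \<in> set D" using derivable_two by blast
  then show ?case by (intro derivableI[of _ D]) (auto simp: justified_def)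
next
  case (min c x n)
  let ?Q = "\<lambda>u v. v = p u"
  from min.IH(2) obtain z where "\<And>m. m < n \<Longrightarrow> derivable ?Q (goedel c) (prod_encode (x, m)) (Suc (z m))"
    by metis
  from derivable_finite[of n ?Q "\<lambda>_. goedel c" "\<lambda>m. prod_encode (x, m)", OF this] obtain E where E: "derivation ?Q E"
    "\<forall>m<n. triple (goedel c) (prod_encode (x, m)) (Suc (z m)) \<in> set E" by auto
  from min.IH(1) obtain D where D: "derivation ?Q D" "triple (goedel c) (prod_encode (x, n)) 0 \<in> set D"
    unfolding derivable_def by blast
  show ?case
    using derivation_append[OF D(1) E(1)] D(2) E(2)
    by (intro derivableI[of _ "D @ E"]) (auto simp: justified_def)
qed (auto intro!: derivableI[of _ "[]"] simp: justified_def)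

lemma evals_iff_derivable: "evals p c x y \<longleftrightarrow> derivable (\<lambda>u v. v = p u) (goedel c) x y"
  using evals_derivable derivation_sound[of "\<lambda>u v. v = p u" p] unfolding derivable_def
  by (metis prog_of_goedel)

section \<open>Finite oracle information and the use principle\<close>

definition initial :: "(nat \<Rightarrow> nat) \<Rightarrow> nat \<Rightarrow> nat list" where
  "initial p m = map p [0..<m]"

lemma length_initial [simp]: "length (initial p m) = m"
  by (simp add: initial_def)

lemma nth_initial [simp]: "i < m \<Longrightarrow> initial p m ! i = p i"
  by (simp add: initial_def)

lemma mem_set_initial: "v \<in> set (initial p m) \<longleftrightarrow> (\<exists>i<m. p i = v)"
  by (auto simp: initial_def)

text \<open>The guard leaves queries beyond the list unanswered instead of returning the default, so
  extending the list preserves evaluations.\<close>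

definition evals_list :: "nat list \<Rightarrow> nat \<Rightarrow> nat \<Rightarrow> nat \<Rightarrow> bool" where
  "evals_list s = derivable (\<lambda>u v. u < length s \<and> v = nth_default 0 s u)"

text \<open>A query clause only asks at the input of its own entry, so any bound above the finitely
  many inputs in \<open>D\<close> suffices.\<close>

lemma derivation_use:
  assumes "derivation (\<lambda>u v. v = p u) D"
  shows "\<exists>m. derivation (\<lambda>u v. u < m \<and> v = p u) D"
  using assms
proof (induction D)
  case (Cons t D)
  let ?x = "pfst (psnd t)" and ?y = "psnd (psnd t)"
  from Cons obtain m where m: "derivation (\<lambda>u v. u < m \<and> v = p u) D" by (auto simp: derivation_Cons)
  have "justified (\<lambda>u v. v = p u) D (pfst t) ?x ?y" using Cons.prems by (simp add: derivation_Cons)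
  then have "justified (\<lambda>u v. u < max m (Suc ?x) \<and> v = p u) D (pfst t) ?x ?y"
    unfolding justified_def by (simp add: less_max_iff_disj)
  moreover have "derivation (\<lambda>u v. u < max m (Suc ?x) \<and> v = p u) D"
    by (rule derivation_mono[OF m]) auto
  ultimately show ?case by (auto simp: derivation_Cons)
qed simp

lemma evals_list_initial: "evals_list (initial p m) = derivable (\<lambda>u v. u < m \<and> v = p u)"
proof -
  have "(\<lambda>u v. u < length (initial p m) \<and> v = nth_default 0 (initial p m) u) = (\<lambda>u v. u < m \<and> v = p u)"
    by (auto simp: nth_default_def fun_eq_iff)
  then show ?thesis by (simp add: evals_list_def)
qed

lemma evals_iff_evals_list: "evals p c x y \<longleftrightarrow> (\<exists>m. evals_list (initial p m) (goedel c) x y)"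
  unfolding evals_iff_derivable evals_list_initial
proof
  assume "derivable (\<lambda>u v. v = p u) (goedel c) x y"
  then show "\<exists>m. derivable (\<lambda>u v. u < m \<and> v = p u) (goedel c) x y"
    unfolding derivable_def using derivation_use by blast
next
  assume "\<exists>m. derivable (\<lambda>u v. u < m \<and> v = p u) (goedel c) x y"
  then show "derivable (\<lambda>u v. v = p u) (goedel c) x y"
    by (auto elim: derivable_mono)
qed

lemma evals_list_mono:
  assumes "evals_list s e x y" "prefix s t" shows "evals_list t e x y"
  using assms unfolding evals_list_def prefix_iff_nth_default by (elim derivable_mono) auto

lemma semidecidable_compose3:
  assumes "semidecidable (\<lambda>z. Q (pfst z) (pfst (psnd z)) (psnd (psnd z)))"
    "computable f" "computable g" "computable h"
  shows "semidecidable (\<lambda>x. Q (f x) (g x) (h x))"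
  using semidecidable_compose[OF assms(1) computable_pair[OF assms(2) computable_pair[OF assms(3,4)]]] by simp

lemma semidecidable_justified:
  assumes Q: "semidecidable (\<lambda>z. Q (pfst z) (pfst (psnd z)) (psnd (psnd z)))"
    and c: "computable s" "computable d" "computable f" "computable g" "computable h"
  shows "semidecidable (\<lambda>x. justified (Q (s x)) (list_decode (d x)) (f x) (g x) (h x))"
  unfolding justified_def
  by (intro semidecidable_intros semidecidable_compose3[OF Q] semidecidable_decidable computable_intros
      c[THEN computable_compose] c)

lemma semidecidable_derivable:
  assumes Q: "semidecidable (\<lambda>z. Q (pfst z) (pfst (psnd z)) (psnd (psnd z)))"
    and c: "computable f" "computable g" "computable h"
  shows "semidecidable (\<lambda>x. derivable (Q x) (f x) (g x) (h x))"
proof -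
  have der: "semidecidable (\<lambda>z. derivation (Q (pfst z)) (list_decode (psnd z)))"
    unfolding derivation_def list_decode_drop_code[symmetric]
    by (intro semidecidable_intros semidecidable_justified[OF Q] computable_intros)
  show ?thesis
    unfolding derivable_def
    by (intro semidecidable_intros der semidecidable_decidable computable_intros c[THEN computable_compose])
qed

lemma semidecidable_evals_list:
  assumes "computable s" "computable f" "computable g" "computable h"
  shows "semidecidable (\<lambda>x. evals_list (list_decode (s x)) (f x) (g x) (h x))"
  unfolding evals_list_def
  by (intro semidecidable_derivable semidecidable_decidable computable_intros
      assms(1)[THEN computable_compose] assms)

section \<open>Semidecidable predicates and indices of c.e. sets\<close>

lemma mem_W_iff: "x \<in> W e \<longleftrightarrow> (\<exists>y. derivable (\<lambda>u v. v = 0) e x y)"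
  unfolding W_def using evals_iff_derivable[of "\<lambda>_. 0"] surj_goedel[of e] by auto

text \<open>Halting is the existence of a finite derivation that can be verified, uniformly in the
  code; this plays the part of a universal program.\<close>

lemma semidecidable_mem_W:
  assumes "computable f" "computable g" shows "semidecidable (\<lambda>x. f x \<in> W (g x))"
  unfolding mem_W_iff
  by (intro semidecidable_intros semidecidable_derivable semidecidable_decidable computable_intros
      assms[THEN computable_compose])

text \<open>The program searches for the least witness and halts exactly when one exists.\<close>

lemma semidecidable_evals:
  assumes "semidecidable P"
  obtains c where "\<And>x. (\<exists>y. evals (\<lambda>_. 0) c x y) \<longleftrightarrow> P x"
proof -
  obtain R where R: "decidable R" "\<And>x. P x \<longleftrightarrow> (\<exists>w. R (prod_encode (x, w)))"
    using assms by (rule semidecidableE) blast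
  from evals_min_decidable[OF R(1)] obtain c where c: "\<And>x y. evals (\<lambda>_. 0) c x y \<longleftrightarrow>
    R (prod_encode (x, y)) \<and> (\<forall>m<y. \<not> R (prod_encode (x, m)))" by blast
  show ?thesis
    using exists_least_iff[of "\<lambda>w. R (prod_encode (_, w))"] by (intro that[of c]) (simp add: c R(2))
qed

text \<open>Hard-wiring a parameter has to be computable on codes. Here 1 is the code of
  \<open>PSucc\<close> and 6 the tag of composition.\<close>

lemma computable_goedel_const_prog: "computable (\<lambda>n. goedel (const_prog n))"
proof -
  have "goedel (const_prog n) = rec_nat 0 (\<lambda>k y. 6 + 4 * prod_encode (1, y)) n" for n
    by (induction n) auto
  then show ?thesis by (simp only:) (intro computable_intros)
qed

inductive_cases evals_PCompE: "evals p (PComp c d) x z"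

text \<open>The s-m-n construction: one program for the binary predicate is composed with a program
  that pairs the input with the constant \<open>n\<close>.\<close>

lemma semidecidable_W_index:
  assumes "semidecidable (\<lambda>z. P (pfst z) (psnd z))"
  obtains f where "computable f" "\<And>n. W (f n) = {x. P n x}"
proof -
  let ?o = "\<lambda>_. 0 :: nat"
  obtain c where c: "\<And>z. (\<exists>y. evals ?o c z y) \<longleftrightarrow> P (pfst z) (psnd z)"
    using semidecidable_evals[OF assms] by blast
  define d where "d n = PPair (const_prog n) id_prog" for n
  have d: "evals ?o (d n) x z \<longleftrightarrow> z = prod_encode (n, x)" for n x z
    unfolding d_def using evals_functional evals.pair[OF evals_const evals_id] by blast
  show ?thesis
  proof (rule that[of "\<lambda>n. goedel (PComp c (d n))"])
    have "computable (\<lambda>n. goedel (const_prog n))" by (rule computable_goedel_const_prog)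
    then show "computable (\<lambda>n. goedel (PComp c (d n)))"
      unfolding d_def goedel.simps by (intro computable_intros)
    fix n
    have "(\<exists>y. evals ?o (PComp c (d n)) x y) \<longleftrightarrow> (\<exists>y. evals ?o c (prod_encode (n, x)) y)" for x
      by (metis d evals.comp evals_PCompE)
    then have "(\<exists>y. evals ?o (PComp c (d n)) x y) \<longleftrightarrow> P n x" for x
      by (simp add: c)
    moreover have "x \<in> W (goedel b) \<longleftrightarrow> (\<exists>y. evals ?o b x y)" for x b
      unfolding W_def using inj_goedel by auto
    ultimately show "W (goedel (PComp c (d n))) = {x. P n x}" by blast
  qed
qed

text \<open>From here on uniformly effective open families are handled as semidecidable relations
  between parameter and basis index; this rule and the next one convert to and from index
  functions.\<close>

lemma uniformly_eff_openI:
  assumes "semidecidable (\<lambda>z. P (pfst z) (psnd z))" "\<And>n. U n = (\<Union>i\<in>{i. P n i}. B i)"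
  shows "uniformly_eff_open B U"
  using semidecidable_W_index[OF assms(1)] assms(2)
  unfolding uniformly_eff_open_def eff_open_set_def by metis

lemma uniformly_eff_openE:
  assumes "uniformly_eff_open B U"
  obtains P where "semidecidable (\<lambda>z. P (pfst z) (psnd z))" "\<And>n. U n = (\<Union>i\<in>{i. P n i}. B i)"
proof -
  obtain f where f: "computable f" "\<And>n. U n = (\<Union>i\<in>W (f n). B i)"
    using assms unfolding uniformly_eff_open_def eff_open_set_def by blast
  show ?thesis
    by (rule that[of "\<lambda>n i. i \<in> W (f n)"])
      (auto simp: f(2) intro!: semidecidable_mem_W computable_intros computable_compose[OF f(1)])
qed

section \<open>Computably overt \<open>\<Pi>\<^sup>0\<^sub>2\<close> sets as effectively open images of Baire space\<close>

lemma mem_cylinder_iff: "p \<in> cylinder s \<longleftrightarrow> initial p (length s) = s"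
  unfolding cylinder_def by (auto simp: list_eq_iff_nth_eq)

lemma mem_cylinder_initial [simp]: "p \<in> cylinder (initial p m)"
  by (simp add: mem_cylinder_iff)

lemma cylinder_Nil [simp]: "cylinder [] = UNIV"
  by (simp add: cylinder_def)

lemma mem_cylinder_nth: "p \<in> cylinder s \<Longrightarrow> i < length s \<Longrightarrow> p i = nth_default 0 s i"
  by (simp add: cylinder_def nth_default_def)

lemma prefix_initial: "m \<le> n \<Longrightarrow> prefix (initial p m) (initial p n)"
  by (simp add: prefix_iff_nth_default nth_default_def)

lemma prefix_initial_if_mem: "p \<in> cylinder s \<Longrightarrow> length s \<le> m \<Longrightarrow> prefix s (initial p m)"
  by (metis mem_cylinder_iff prefix_initial)

text \<open>\<open>H k s\<close> records that input prefix \<open>k\<close> has produced output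
  prefix \<open>s\<close>. The exact images under \<open>H\<close> yield effective openness, and the
  unbounded output lengths yield computability of \<open>g\<close>.\<close>

lemma overt_Pi02_effective_image:
  fixes R :: "nat \<Rightarrow> nat list \<Rightarrow> bool" and S :: "nat list \<Rightarrow> bool"
  assumes R_sd: "semidecidable (\<lambda>z. R (pfst z) (list_decode (psnd z)))"
    and R_mono: "\<And>n s t. R n s \<Longrightarrow> prefix s t \<Longrightarrow> R n t"
    and S_sd: "semidecidable (\<lambda>z. S (list_decode z))"
    and A: "\<And>p. p \<in> A \<longleftrightarrow> (\<forall>n. \<exists>m. R n (initial p m))"
    and S: "\<And>s. S s \<longleftrightarrow> cylinder s \<inter> A \<noteq> {}"
    and ne: "A \<noteq> {}"
  obtains g :: "(nat \<Rightarrow> nat) \<Rightarrow> nat \<Rightarrow> nat" and H :: "nat list \<Rightarrow> nat list \<Rightarrow> bool"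
  where "semidecidable (\<lambda>z. H (list_decode (pfst z)) (list_decode (psnd z)))"
    "range g = A"
    "\<And>k. \<exists>s. H k s"
    "\<And>k s. H k s \<Longrightarrow> g ` cylinder k = A \<inter> cylinder s"
    "\<And>q n. \<exists>k s. q \<in> cylinder k \<and> H k s \<and> n \<le> length s"
proof -
  \<comment> \<open>Proper growth makes the limit a total sequence; \<open>S t\<close> keeps every
    stage extendable within \<open>A\<close>.\<close>
  define V where "V n s t \<longleftrightarrow> prefix s t \<and> length s < length t \<and> S t \<and> R n t" for n s t
  have "semidecidable (\<lambda>z. V (pfst z) (list_decode (pfst (psnd z))) (list_decode (psnd (psnd z))))"
    unfolding V_def
    by (intro semidecidable_intros semidecidable_compose[OF S_sd] semidecidable_compose2[OF R_sd]
        semidecidable_decidable computable_intros)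
  then obtain D0 where D0: "decidable D0"
    "\<And>z. V (pfst z) (list_decode (pfst (psnd z))) (list_decode (psnd (psnd z))) \<longleftrightarrow>
      (\<exists>w. D0 (prod_encode (z, w)))"
    by (rule semidecidableE) blast
  \<comment> \<open>The number \<open>w\<close> packs an extension with a witness for
    \<open>V\<close>, so validity of a selection is decidable.\<close>
  define D where "D n s w \<longleftrightarrow> D0 (prod_encode (triple n s (pfst w), psnd w))" for n s w
  have D_dec: "decidable (\<lambda>x. D (f x) (a x) (b x))"
    if "computable f" "computable a" "computable b" for f a b
    unfolding D_def by (intro computable_intros decidable_compose[OF D0(1)] that)
  have V_D: "V n (list_decode s) (list_decode t) \<longleftrightarrow> (\<exists>w. pfst w = t \<and> D n s w)" for n s t
    using D0(2)[of "triple n s t"] unfolding D_def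
    by simp (metis prod_encode_inverse fst_conv snd_conv)
  have DV: "V n (list_decode s) (list_decode (pfst w))" if "D n s w" for n s w
    using that V_D by blast

  define pick where "pick n s a = (if D n s a then a else LEAST w. D n s w)" for n s a
  \<comment> \<open>This is the graph of \<open>pick\<close> wherever a valid selection exists, in
    decidable form: minimality becomes a bounded quantifier.\<close>
  define step where
    "step n s a w \<longleftrightarrow> (D n s a \<and> w = a) \<or> (\<not> D n s a \<and> D n s w \<and> (\<forall>v<w. \<not> D n s v))" for n s a w
  have step_pick: "w = pick n s a" if "step n s a w" for n s a w
    using that unfolding step_def pick_def by (auto intro!: Least_equality[symmetric] leI)
  have extension: "\<exists>w. D n s w \<and> p \<in> cylinder (list_decode (pfst w))"
    if p: "p \<in> A" "p \<in> cylinder (list_decode s)" for n s p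
  proof -
    obtain m where m: "R n (initial p m)" using p(1) A by blast
    \<comment> \<open>Length at least \<open>m\<close> secures requirement \<open>n\<close>;
      exceeding the length of \<open>list_decode s\<close> makes the extension proper.\<close>
    define t where "t = initial p (max m (Suc (length (list_decode s))))"
    have "p \<in> cylinder t" by (simp add: t_def)
    moreover from this have "S t" using S p(1) by blast
    moreover have "R n t" unfolding t_def by (rule R_mono[OF m]) (simp add: prefix_initial)
    moreover have "prefix (list_decode s) t" unfolding t_def
      by (rule prefix_initial_if_mem[OF p(2)]) simp
    ultimately show ?thesis
      using V_D[of n s "list_encode t"] unfolding V_def by (auto simp: t_def)
  qed
  have pick_step: "step n s a (pick n s a)" and pick_D: "D n s (pick n s a)"
    if "S (list_decode s)" for n s a
  proof -
    have "\<exists>w. D n s w" using that S extension by blast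
    then show "step n s a (pick n s a)" "D n s (pick n s a)"
      unfolding step_def pick_def by (auto intro: LeastI_ex dest: not_less_Least)
  qed

  \<comment> \<open>Stage \<open>n\<close> after \<open>n\<close> selections, as a code; it starts
    at 0, the code of the empty sequence.\<close>
  define h where "h q = rec_nat 0 (\<lambda>n s. pfst (pick n s (q n)))" for q
  have h_0 [simp]: "h q 0 = 0" and h_Suc: "h q (Suc n) = pfst (pick n (h q n) (q n))" for q n
    by (simp_all add: h_def)
  have S_h: "S (list_decode (h q n))" for q n
  proof (induction n)
    case 0
    show ?case using ne by (simp add: S)
  next
    case (Suc n)
    then show ?case using DV[OF pick_D[OF Suc]] by (simp add: h_Suc V_def)
  qed
  have V_h: "V n (list_decode (h q n)) (list_decode (h q (Suc n)))" for q n
    unfolding h_Suc by (rule DV[OF pick_D[OF S_h]])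
  have prefix_h: "prefix (list_decode (h q m)) (list_decode (h q n))" if "m \<le> n" for q m n
    using that
  proof (induction n rule: dec_induct)
    case (step n)
    then show ?case using V_h[of n q] prefix_order.trans unfolding V_def by blast
  qed simp
  have length_h: "n \<le> length (list_decode (h q n))" for q n
  proof (induction n)
    case (Suc n)
    then show ?case using V_h[of n q] unfolding V_def by linarith
  qed simp

  \<comment> \<open>Stage \<open>Suc i\<close> has length greater than \<open>i\<close>, so the
    default never shows.\<close>
  define g where "g q i = nth_default 0 (list_decode (h q (Suc i))) i" for q i
  have g_cyl: "g q \<in> cylinder (list_decode (h q n))" for q n
    unfolding cylinder_def
  proof (intro CollectI allI impI)
    fix i assume i: "i < length (list_decode (h q n))"
    have i': "i < length (list_decode (h q (Suc i)))" using length_h[of "Suc i" q] by linarith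
    have "nth_default 0 (list_decode (h q (Suc i))) i = nth_default 0 (list_decode (h q n)) i"
    proof (cases "Suc i \<le> n")
      case True
      from prefix_h[OF this, of q] i' show ?thesis unfolding prefix_iff_nth_default by blast
    next
      case False
      then have "n \<le> Suc i" by simp
      from prefix_h[OF this, of q] i show ?thesis unfolding prefix_iff_nth_default by metis
    qed
    then show "g q i = list_decode (h q n) ! i" unfolding g_def using i by (simp add: nth_default_def)
  qed
  have g_A: "g q \<in> A" for q
    unfolding A
  proof
    fix n
    have "R n (list_decode (h q (Suc n)))" using V_h[of n q] by (simp add: V_def)
    then show "\<exists>m. R n (initial (g q) m)"
      using g_cyl[of q "Suc n"] unfolding mem_cylinder_iff
      by (intro exI[of _ "length (list_decode (h q (Suc n)))"]) simp
  qed
  have g_eqI: "g q = p" if unbounded: "\<And>n. \<exists>m\<ge>n. p \<in> cylinder (list_decode (h q m))" for q p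
  proof (rule ext)
    fix i
    obtain m where m: "Suc i \<le> m" "p \<in> cylinder (list_decode (h q m))" using unbounded[of "Suc i"] by blast
    then have i: "i < length (list_decode (h q m))" using length_h[of m q] by linarith
    show "g q i = p i" using mem_cylinder_nth[OF m(2) i] mem_cylinder_nth[OF g_cyl i] by simp
  qed

  \<comment> \<open>\<open>ws\<close> is the finite history of the selections made on input
    \<open>k\<close>. Quantifying over histories makes \<open>H\<close> semidecidable although
    \<open>h\<close> is defined with \<open>LEAST\<close>.\<close>
  define chain where "chain k ws \<longleftrightarrow> pfst (nth_default 0 ws 0) = 0 \<and>
    (\<forall>n<length k. step n (pfst (nth_default 0 ws n)) (nth_default 0 k n) (nth_default 0 ws (Suc n)))"
    for k ws
  define H where "H k s \<longleftrightarrow> (\<exists>ws. chain k ws \<and> s = list_decode (pfst (nth_default 0 ws (length k))))"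
    for k s
  have chain_h: "pfst (nth_default 0 ws n) = h q n"
    if "q \<in> cylinder k" "chain k ws" "n \<le> length k" for q k ws n
    using that(3)
  proof (induction n)
    case 0
    show ?case using that(2) by (simp add: chain_def)
  next
    case (Suc n)
    then have "step n (h q n) (nth_default 0 k n) (nth_default 0 ws (Suc n))"
      using that(2) unfolding chain_def by (metis Suc_le_lessD Suc_leD)
    then have "nth_default 0 ws (Suc n) = pick n (h q n) (nth_default 0 k n)" by (rule step_pick)
    then show ?case using mem_cylinder_nth[OF that(1), of n] Suc.prems by (simp add: h_Suc)
  qed
  have chain_ex: "\<exists>ws. chain k ws" if "q \<in> cylinder k" for q k
  proof -
    \<comment> \<open>The history begins with 0, whose first component is 0, the code of the empty
      sequence.\<close>
    define u where "u i = (case i of 0 \<Rightarrow> 0 | Suc j \<Rightarrow> pick j (h q j) (q j))" for i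
    have u: "pfst (u i) = h q i" for i by (cases i) (simp_all add: u_def h_Suc prod_decode_0)
    have "chain k (initial u (Suc (length k)))"
      unfolding chain_def using u pick_step[OF S_h] mem_cylinder_nth[OF that, symmetric]
      by (auto simp: nth_default_def u_def prod_decode_0 split: if_splits)
    then show ?thesis by blast
  qed
  have H_h: "H k s \<longleftrightarrow> s = list_decode (h q (length k))" if "q \<in> cylinder k" for q k s
    unfolding H_def using chain_h[OF that] chain_ex[OF that] by auto
  have nonempty: "\<exists>q. q \<in> cylinder k" for k by (auto simp: cylinder_def)

  show ?thesis
  proof (rule that[of H g])
    have chain_dec: "decidable (\<lambda>x. chain (list_decode (a x)) (list_decode (b x)))"
      if "computable a" "computable b" for a b
      unfolding chain_def step_def by (intro computable_intros D_dec that that[THEN computable_compose])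
    show "semidecidable (\<lambda>z. H (list_decode (pfst z)) (list_decode (psnd z)))"
      unfolding H_def list_decode_eq
      by (intro semidecidable_intros semidecidable_decidable chain_dec computable_intros)
    show "\<exists>s. H k s" for k using H_h nonempty by blast
    show image: "g ` cylinder k = A \<inter> cylinder s" if H: "H k s" for k s
    proof (intro equalityI subsetI)
      fix p assume "p \<in> g ` cylinder k"
      then show "p \<in> A \<inter> cylinder s" using g_A g_cyl H_h H by auto
    next
      fix p assume p: "p \<in> A \<inter> cylinder s"
      \<comment> \<open>To reach \<open>p\<close>, the input continues \<open>k\<close> with valid
        selections that stay along \<open>p\<close>; being valid, they are accepted by
        \<open>pick\<close> in place of the default.\<close>
      define c where "c n u = (SOME w. D n u w \<and> p \<in> cylinder (list_decode (pfst w)))" for n u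
      have c: "D n u (c n u)" "p \<in> cylinder (list_decode (pfst (c n u)))"
        if "p \<in> cylinder (list_decode u)" for n u
        using someI_ex[OF extension[of p u n]] p that unfolding c_def by auto
      define u where "u = rec_nat (list_encode s) (\<lambda>m u. pfst (c (length k + m) u))"
      have u_cyl: "p \<in> cylinder (list_decode (u m))" for m
        by (induction m) (use p c in \<open>auto simp: u_def\<close>)
      define q where "q n = (if n < length k then k ! n else c n (u (n - length k)))" for n
      have q: "q \<in> cylinder k" by (simp add: cylinder_def q_def)
      have h_u: "h q (length k + m) = u m" for m
      proof (induction m)
        case 0
        show ?case using H_h[OF q] H by (simp add: u_def)
      next
        case (Suc m)
        have "D (length k + m) (u m) (q (length k + m))" using c(1)[OF u_cyl] by (simp add: q_def)
        then show ?case using Suc by (simp add: h_Suc pick_def) (simp add: u_def q_def)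
      qed
      have "g q = p"
      proof (rule g_eqI)
        fix n
        show "\<exists>m\<ge>n. p \<in> cylinder (list_decode (h q m))"
          using u_cyl h_u by (intro exI[of _ "length k + n"]) simp
      qed
      then show "p \<in> g ` cylinder k" using q by blast
    qed
    show "range g = A" using image[of "[]"] H_h[of _ "[]"] by auto
    show "\<exists>k s. q \<in> cylinder k \<and> H k s \<and> n \<le> length s" for q n
      by (intro exI[of _ "initial q n"] exI[of _ "list_decode (h q n)"])
        (simp add: H_h[of q] length_h)
  qed
qed

section \<open>The domain of the standard representation\<close>

text \<open>Rewrites the set as countably many open requirements, each confirmed by a finite prefix
  and then permanent, as the stagewise construction expects.\<close>

lemma Pi02_normal_form:
  assumes "Pi02 C"
  obtains R where "semidecidable (\<lambda>z. R (pfst z) (list_decode (psnd z)))"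
    "\<And>n s t. R n s \<Longrightarrow> prefix s t \<Longrightarrow> R n t"
    "\<And>q. q \<in> C \<longleftrightarrow> (\<forall>n. \<exists>m. R n (initial q m))"
proof -
  obtain U V where U: "uniformly_eff_open baire_basis U" and V: "uniformly_eff_open baire_basis V"
    and C: "- C = (\<Union>n. U n - V n)"
    using assms unfolding Pi02_def Sigma02_def by blast
  obtain PU where PU: "semidecidable (\<lambda>z. PU (pfst z) (psnd z))"
    "\<And>n. U n = (\<Union>i\<in>{i. PU n i}. baire_basis i)" using uniformly_eff_openE[OF U] by metis
  obtain PV where PV: "semidecidable (\<lambda>z. PV (pfst z) (psnd z))"
    "\<And>n. V n = (\<Union>i\<in>{i. PV n i}. baire_basis i)" using uniformly_eff_openE[OF V] by metis
  obtain E where E: "decidable E" "\<And>z. PU (pfst z) (psnd z) \<longleftrightarrow> (\<exists>w. E (prod_encode (z, w)))"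
    using PU(1) by (rule semidecidableE) blast
  have PU_E: "PU n i \<longleftrightarrow> (\<exists>w. E (prod_encode (prod_encode (n, i), w)))" for n i
    using E(2)[of "prod_encode (n, i)"] by simp
  \<comment> \<open>A single requirement, indexed by \<open>n\<close>, \<open>i\<close> and a witness \<open>w\<close> that the cylinder with index \<open>i\<close>
    is enumerated into \<open>U n\<close>, is open: leaving that cylinder is witnessed by finitely many values.\<close>
  define R where "R k s \<longleftrightarrow> \<not> E (prod_encode (prod_encode (pfst k, pfst (psnd k)), psnd (psnd k))) \<or>
    (\<exists>j<length (list_decode (pfst (psnd k))). j < length s \<and>
       nth_default 0 s j \<noteq> nth_default 0 (list_decode (pfst (psnd k))) j) \<or>
    (\<exists>c. PV (pfst k) c \<and> prefix (list_decode c) s)" for k s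
  have in_C: "q \<in> C \<longleftrightarrow> (\<forall>n i w. E (prod_encode (prod_encode (n, i), w)) \<longrightarrow>
    q \<in> cylinder (list_decode i) \<longrightarrow> (\<exists>c. PV n c \<and> q \<in> cylinder (list_decode c)))" for q
  proof -
    have "q \<in> C \<longleftrightarrow> (\<forall>n. q \<in> U n \<longrightarrow> q \<in> V n)" using C by auto
    then show ?thesis unfolding PU(2) PV(2) PU_E baire_basis_def by blast
  qed
  have R_initial: "(\<exists>m. R (triple n i w) (initial q m)) \<longleftrightarrow>
    (E (prod_encode (prod_encode (n, i), w)) \<longrightarrow> q \<in> cylinder (list_decode i) \<longrightarrow>
      (\<exists>c. PV n c \<and> q \<in> cylinder (list_decode c)))" for n i w q
  proof -
    have 1: "(\<exists>m. \<exists>j<length s. j < m \<and> nth_default 0 (initial q m) j \<noteq> nth_default 0 s j) \<longleftrightarrow>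
      q \<notin> cylinder s" for s
      by (auto simp: cylinder_def nth_default_def)
    have 2: "(\<exists>m. prefix s (initial q m)) \<longleftrightarrow> q \<in> cylinder s" for s
      by (auto simp: cylinder_def prefix_iff_nth_default nth_default_def)
    show ?thesis
      unfolding R_def prod_encode_inverse fst_conv snd_conv length_initial ex_disj_distrib 1
      using 2 by blast
  qed
  show ?thesis
  proof (rule that[of R])
    show "semidecidable (\<lambda>z. R (pfst z) (list_decode (psnd z)))"
      unfolding R_def
      by (intro semidecidable_intros semidecidable_compose2[OF PV(1)] semidecidable_decidable
          decidable_compose[OF E(1)] computable_intros)
    show "R n t" if "R n s" "prefix s t" for n s t
    proof -
      have "nth_default 0 s j = nth_default 0 t j" "j < length t" if "j < length s" for j
        using that \<open>prefix s t\<close> by (simp_all add: prefix_iff_nth_default)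
      then show ?thesis
        using that unfolding R_def by (metis prefix_order.trans)
    qed
    show "q \<in> C \<longleftrightarrow> (\<forall>n. \<exists>m. R n (initial q m))" for q
      unfolding in_C R_initial[symmetric] by (metis prod.collapse prod_decode_inverse)
  qed
qed

section \<open>Names in the standard representation\<close>

lemma inj_on_canonical_embedding:
  assumes "effective_topological_space X B"
  shows "inj_on (canonical_embedding B) (topspace X)"
proof (rule inj_onI)
  fix x y assume xy: "x \<in> topspace X" "y \<in> topspace X" "canonical_embedding B x = canonical_embedding B y"
  have B: "x \<in> B i \<longleftrightarrow> y \<in> B i" for i using xy(3) unfolding canonical_embedding_def by blast
  show "x = y"
  proof (rule ccontr)
    assume "x \<noteq> y"
    then obtain U where "openin X U" "x \<notin> U \<longleftrightarrow> y \<in> U"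
      using assms xy unfolding effective_topological_space_def t0_space_def by blast
    then show False using assms B unfolding effective_topological_space_def by blast
  qed
qed

text \<open>Injectivity of the embedding, a consequence of T0, removes \<open>the_inv_into\<close>
  from all later arguments.\<close>

lemma standard_representation_eq_Some:
  assumes "effective_topological_space X B"
  shows "standard_representation X B p = Some x \<longleftrightarrow>
    x \<in> topspace X \<and> enumerated_set p = canonical_embedding B x"
proof (cases "enumerated_set p \<in> canonical_embedding B ` topspace X")
  case True
  then obtain y where y: "y \<in> topspace X" "enumerated_set p = canonical_embedding B y" by blast
  note inj = inj_on_canonical_embedding[OF assms]
  have "standard_representation X B p = Some y"
    using True the_inv_into_f_f[OF inj y(1)] by (simp add: standard_representation_def y(2))
  then show ?thesis using y inj_onD[OF inj] by auto
next
  case False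
  then show ?thesis by (auto simp: standard_representation_def)
qed

text \<open>A prefix imposes only finitely many positive conditions. A point meeting them gets a
  name that continues \<open>s\<close> by listing all its basic neighborhoods, with 0 as filler at
  the other indices.\<close>

lemma standard_representation_cylinder:
  assumes "effective_topological_space X B"
  shows "(\<exists>p\<in>cylinder s. standard_representation X B p = Some x) \<longleftrightarrow>
    x \<in> topspace X \<and> (\<forall>n. Suc n \<in> set s \<longrightarrow> x \<in> B n)" (is "?L \<longleftrightarrow> ?R")
proof
  assume ?L
  then obtain p where p: "p \<in> cylinder s" "x \<in> topspace X" "enumerated_set p = canonical_embedding B x"
    by (auto simp: standard_representation_eq_Some[OF assms])
  have "x \<in> B n" if "Suc n \<in> set s" for n
  proof -
    from that obtain i where "i < length s" "s ! i = Suc n" unfolding in_set_conv_nth by blast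
    then have "p i = n + 1" using p(1) by (simp add: cylinder_def)
    then have "n \<in> enumerated_set p" unfolding enumerated_set_def by blast
    then show ?thesis unfolding p(3) canonical_embedding_def by simp
  qed
  with p(2) show ?R by blast
next
  assume R: ?R
  define r where "r n = (if x \<in> B n then Suc n else 0)" for n
  define p where "p i = (if i < length s then s ! i else r (i - length s))" for i
  have "standard_representation X B p = Some x"
    unfolding standard_representation_eq_Some[OF assms]
  proof (intro conjI equalityI subsetI)
    show "x \<in> topspace X" using R by blast
  next
    fix n assume "n \<in> enumerated_set p"
    then obtain i where i: "p i = Suc n" by (auto simp: enumerated_set_def)
    show "n \<in> canonical_embedding B x"
    proof (cases "i < length s")
      case True
      then have "Suc n \<in> set s" using i by (metis nth_mem p_def)
      then show ?thesis using R by (simp add: canonical_embedding_def)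
    next
      case False
      then show ?thesis using i by (auto simp: p_def r_def canonical_embedding_def split: if_splits)
    qed
  next
    fix n assume "n \<in> canonical_embedding B x"
    then have "p (length s + n) = n + 1" by (simp add: p_def r_def canonical_embedding_def)
    then show "n \<in> enumerated_set p" unfolding enumerated_set_def by blast
  qed
  moreover have "p \<in> cylinder s" by (simp add: cylinder_def p_def)
  ultimately show ?L by blast
qed

text \<open>The \<open>eventually\<close> form combines finitely many use bounds without explicit
  maxima.\<close>

lemma eventually_evals_list:
  assumes "evals p c x y"
  shows "\<forall>\<^sub>F m in sequentially. evals_list (initial p m) (goedel c) x y"
  using assms evals_list_mono[OF _ prefix_initial]
  unfolding evals_iff_evals_list eventually_sequentially by blast

lemma evals_list_cylinder: "evals_list s (goedel c) x y \<Longrightarrow> p \<in> cylinder s \<Longrightarrow> evals p c x y"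
  unfolding evals_iff_evals_list mem_cylinder_iff by metis

lemma computably_admissibleE:
  assumes "computably_admissible X B \<delta>"
  obtains cF cG where
    "\<And>p x. standard_representation X B p = Some x \<Longrightarrow>
      \<exists>q. \<delta> q = Some x \<and> (\<forall>n. evals p cF n (q n))"
    "\<And>q x. \<delta> q = Some x \<Longrightarrow>
      \<exists>r. standard_representation X B r = Some x \<and> (\<forall>n. evals q cG n (r n))"
proof -
  obtain F G where F: "partial_computable F" "standard_representation X B = \<delta> \<circ>\<^sub>m F"
    and G: "partial_computable G" "\<delta> = standard_representation X B \<circ>\<^sub>m G"
    using assms unfolding computably_admissible_def by blast
  obtain cF cG where c: "\<And>p q n. F p = Some q \<Longrightarrow> evals p cF n (q n)"
    "\<And>p q n. G p = Some q \<Longrightarrow> evals p cG n (q n)"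
    using F(1) G(1) unfolding partial_computable_def by blast
  show ?thesis
  proof (rule that[of cF cG])
    fix p x assume "standard_representation X B p = Some x"
    then have "(\<delta> \<circ>\<^sub>m F) p = Some x" unfolding F(2) .
    then show "\<exists>q. \<delta> q = Some x \<and> (\<forall>n. evals p cF n (q n))"
      using c(1) by (auto simp: map_comp_Some_iff)
  next
    fix q x assume "\<delta> q = Some x"
    then have "(standard_representation X B \<circ>\<^sub>m G) q = Some x" using G(2) by metis
    then show "\<exists>r. standard_representation X B r = Some x \<and> (\<forall>n. evals q cG n (r n))"
      using c(2) by (auto simp: map_comp_Some_iff)
  qed
qed

text \<open>
  A point \<open>p\<close> lies in the domain of the standard representation iff the translation \<open>q\<close> of \<open>p\<close> is
  total, lies in the domain of \<open>\<delta>\<close>, and its translation back enumerates the same set as \<open>p\<close>. Once \<open>q\<close>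
  and its translation are total, equality of the two enumerated sets needs no negative information.
\<close>

lemma standard_representation_dom_Pi02:
  assumes X: "effective_topological_space X B" and adm: "computably_admissible X B \<delta>"
    and Pi: "Pi02 (dom \<delta>)"
  obtains R where "semidecidable (\<lambda>z. R (pfst z) (list_decode (psnd z)))"
    "\<And>n s t. R n s \<Longrightarrow> prefix s t \<Longrightarrow> R n t"
    "\<And>p. p \<in> dom (standard_representation X B) \<longleftrightarrow> (\<forall>n. \<exists>m. R n (initial p m))"
proof -
  let ?\<rho> = "standard_representation X B"
  note \<rho> = standard_representation_eq_Some[OF X]
  obtain cF cG where F: "\<And>p x. ?\<rho> p = Some x \<Longrightarrow> \<exists>q. \<delta> q = Some x \<and> (\<forall>n. evals p cF n (q n))"
    and G: "\<And>q x. \<delta> q = Some x \<Longrightarrow> \<exists>r. ?\<rho> r = Some x \<and> (\<forall>n. evals q cG n (r n))"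
    using computably_admissibleE[OF adm] by blast
  obtain R0 where R0: "semidecidable (\<lambda>z. R0 (pfst z) (list_decode (psnd z)))"
    "\<And>n s t. R0 n s \<Longrightarrow> prefix s t \<Longrightarrow> R0 n t"
    "\<And>q. q \<in> dom \<delta> \<longleftrightarrow> (\<forall>n. \<exists>m. R0 n (initial q m))"
    using Pi02_normal_form[OF Pi] by blast
  \<comment> \<open>\<open>t\<close> is a finite part of the translation \<open>q\<close>; being
    longer than \<open>i\<close>, it forces totality of \<open>q\<close>. The last two clauses
    compare the entries at position \<open>i\<close> of both enumerations, exempting the filler 0.
    Every clause persists when \<open>s\<close> grows.\<close>
  define R where "R i s \<longleftrightarrow> i < length s \<and> (\<exists>t. i < length t \<and> R0 i t \<and>
    (\<forall>j<length t. evals_list s (goedel cF) j (nth_default 0 t j)) \<and>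
    (\<exists>v. evals_list t (goedel cG) i v \<and> (v = 0 \<or> v \<in> set s)) \<and>
    (nth_default 0 s i = 0 \<or> (\<exists>j. evals_list t (goedel cG) j (nth_default 0 s i))))" for i s
  show ?thesis
  proof (rule that[of R])
    show "semidecidable (\<lambda>z. R (pfst z) (list_decode (psnd z)))"
      unfolding R_def
      by (intro semidecidable_intros semidecidable_compose2[OF R0(1)] semidecidable_evals_list
          semidecidable_decidable computable_intros)
    show "R n t" if "R n s" "prefix s t" for n s t
    proof -
      have "n < length s" using that(1) by (simp add: R_def)
      then have t: "n < length t" "nth_default 0 s n = nth_default 0 t n"
        using that(2) by (simp_all add: prefix_iff_nth_default)
      from that(1) obtain u where u: "n < length u" "R0 n u"
        "\<forall>j<length u. evals_list s (goedel cF) j (nth_default 0 u j)"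
        "\<exists>v. evals_list u (goedel cG) n v \<and> (v = 0 \<or> v \<in> set s)"
        "nth_default 0 s n = 0 \<or> (\<exists>j. evals_list u (goedel cG) j (nth_default 0 s n))"
        unfolding R_def by blast
      have "\<forall>j<length u. evals_list t (goedel cF) j (nth_default 0 u j)"
        using u(3) evals_list_mono[OF _ that(2)] by blast
      moreover have "\<exists>v. evals_list u (goedel cG) n v \<and> (v = 0 \<or> v \<in> set t)" using u(4) set_mono_prefix[OF that(2)] by blast
      ultimately show ?thesis using u(1,2,5) t unfolding R_def by auto
    qed
    show "p \<in> dom ?\<rho> \<longleftrightarrow> (\<forall>n. \<exists>m. R n (initial p m))" for p
    proof
      assume "p \<in> dom ?\<rho>"
      then obtain x where x: "?\<rho> p = Some x" by blast
      obtain q where q: "\<delta> q = Some x" "\<And>n. evals p cF n (q n)" using F[OF x] by blast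
      obtain r where r: "?\<rho> r = Some x" "\<And>n. evals q cG n (r n)" using G[OF q(1)] by blast
      have "enumerated_set p = enumerated_set r" using x r(1) \<rho> by metis
      then have enum: "(\<exists>i. p i = Suc n) \<longleftrightarrow> (\<exists>i. r i = Suc n)" for n
        unfolding enumerated_set_def by auto
      show "\<forall>n. \<exists>m. R n (initial p m)"
      proof
        fix n
        \<comment> \<open>\<open>l\<close> and \<open>j\<close> are positions where the other
          enumeration lists the given entry, unless that entry is the filler 0.\<close>
        obtain l where l: "r n = 0 \<or> p l = r n" using enum by (metis not0_implies_Suc)
        obtain j where j: "p n = 0 \<or> r j = p n" using enum by (metis not0_implies_Suc)
        \<comment> \<open>The bounds are chosen in order: first a prefix of \<open>q\<close> long
          enough for the back translation, then a prefix of \<open>p\<close> long enough to compute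
          that prefix.\<close>
        have "\<forall>\<^sub>F m in sequentially. R0 n (initial q m)"
          using R0(2)[OF _ prefix_initial] R0(3) q(1) unfolding eventually_sequentially by blast
        then have "\<forall>\<^sub>F m in sequentially. n < m \<and> R0 n (initial q m) \<and>
            evals_list (initial q m) (goedel cG) n (r n) \<and> evals_list (initial q m) (goedel cG) j (r j)"
          by (intro eventually_conj eventually_gt_at_top eventually_evals_list r(2))
        then obtain m where m: "n < m" "R0 n (initial q m)"
            "evals_list (initial q m) (goedel cG) n (r n)" "evals_list (initial q m) (goedel cG) j (r j)"
          using eventually_happens'[OF sequentially_bot] by blast
        have "\<forall>\<^sub>F k in sequentially. \<forall>i\<in>{..<m}. evals_list (initial p k) (goedel cF) i (q i)"
          by (intro eventually_ball_finite ballI eventually_evals_list q(2)) simp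
        then have "\<forall>\<^sub>F k in sequentially. n < k \<and> l < k \<and>
            (\<forall>i\<in>{..<m}. evals_list (initial p k) (goedel cF) i (q i))"
          by (intro eventually_conj eventually_gt_at_top)
        then obtain k where k: "n < k" "l < k" "\<forall>i<m. evals_list (initial p k) (goedel cF) i (q i)"
          using eventually_happens'[OF sequentially_bot] by blast
        have "r n = 0 \<or> r n \<in> set (initial p k)" using l k(2) by (auto simp: mem_set_initial)
        moreover have "nth_default 0 (initial p k) n = p n" "\<forall>i<m. nth_default 0 (initial q m) i = q i"
          using k(1) by (simp_all add: nth_default_def)
        ultimately have "R n (initial p k)"
          unfolding R_def using m k j by (intro conjI exI[of _ "initial q m"]) auto
        then show "\<exists>m. R n (initial p m)" by blast
      qed
    next
      assume "\<forall>n. \<exists>m. R n (initial p m)"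
      then obtain m where m: "\<And>n. R n (initial p (m n))" by metis
      then obtain t where t: "\<And>n. n < length (t n)" "\<And>n. R0 n (t n)"
        "\<And>n j. j < length (t n) \<Longrightarrow> evals_list (initial p (m n)) (goedel cF) j (nth_default 0 (t n) j)"
        "\<And>n. \<exists>v. evals_list (t n) (goedel cG) n v \<and> (v = 0 \<or> v \<in> set (initial p (m n)))"
        "\<And>n. nth_default 0 (initial p (m n)) n = 0 \<or>
          (\<exists>j. evals_list (t n) (goedel cG) j (nth_default 0 (initial p (m n)) n))"
        unfolding R_def by metis
      have p_n: "nth_default 0 (initial p (m n)) n = p n" for n
        using m[of n] by (simp add: R_def nth_default_def)
      \<comment> \<open>All pieces \<open>t n\<close> are computed from \<open>p\<close> by the same
        program, so by determinism they are prefixes of this one diagonal sequence.\<close>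
      define q where "q n = nth_default 0 (t n) n" for n
      have evF: "evals p cF j (nth_default 0 (t n) j)" if "j < length (t n)" for n j
        using t(3)[OF that] evals_list_cylinder mem_cylinder_initial by blast
      have q_t: "q \<in> cylinder (t n)" for n
        unfolding cylinder_def
        using evals_functional[OF evF[OF t(1)] evF] by (auto simp: q_def nth_default_def t(1))
      have "R0 n (initial q (length (t n)))" for n
        using q_t[of n] t(2)[of n] unfolding mem_cylinder_iff by simp
      then obtain x where x: "\<delta> q = Some x" using R0(3) by blast
      obtain r where r: "?\<rho> r = Some x" "\<And>n. evals q cG n (r n)" using G[OF x] by blast
      have r_t: "r j = v" if "evals_list (t n) (goedel cG) j v" for n j v
        using evals_functional[OF r(2) evals_list_cylinder[OF that q_t]] .
      have "\<exists>j. p j = Suc n" if "r i = Suc n" for i n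
        using t(4)[of i] r_t that by (force simp: mem_set_initial)
      moreover have "\<exists>j. r j = Suc n" if "p i = Suc n" for i n
        using t(5)[of i] r_t that unfolding p_n by fastforce
      ultimately have "enumerated_set p = enumerated_set r"
        unfolding enumerated_set_def by auto
      then have "?\<rho> p = Some x" using r(1) \<rho> by metis
      then show "p \<in> dom ?\<rho>" by blast
    qed
  qed
qed

lemma standard_representation_dom_overt:
  assumes X: "effective_topological_space X B" and rep: "is_representation X \<delta>"
    and adm: "computably_admissible X B \<delta>" and overt: "computably_overt (dom \<delta>)"
  shows "semidecidable (\<lambda>z. cylinder (list_decode z) \<inter> dom (standard_representation X B) \<noteq> {})"
proof -
  let ?\<rho> = "standard_representation X B"
  note \<rho> = standard_representation_eq_Some[OF X]
  obtain cF cG where "\<And>p x. ?\<rho> p = Some x \<Longrightarrow> \<exists>q. \<delta> q = Some x \<and> (\<forall>n. evals p cF n (q n))"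
    and G: "\<And>q x. \<delta> q = Some x \<Longrightarrow> \<exists>r. ?\<rho> r = Some x \<and> (\<forall>n. evals q cG n (r n))"
    using computably_admissibleE[OF adm] by blast
  obtain e where e: "list_encode ` {s. cylinder s \<inter> dom \<delta> \<noteq> {}} = W e"
    using overt unfolding computably_overt_def ce_def by blast
  have mem_e: "list_encode s \<in> W e \<longleftrightarrow> cylinder s \<inter> dom \<delta> \<noteq> {}" for s
    unfolding e[symmetric] by (simp add: image_iff list_encode_eq)
  \<comment> \<open>\<open>c\<close> ranges over cylinders known to contain a
    \<open>\<delta>\<close>-name. Its back translation must list the nonzero entries of
    \<open>s\<close>, at any positions \<open>j\<close>, since only the enumerated set
    matters.\<close>
  define S where "S s \<longleftrightarrow> (\<exists>c. c \<in> W e \<and> (\<forall>i<length s. nth_default 0 s i = 0 \<or>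
    (\<exists>j. evals_list (list_decode c) (goedel cG) j (nth_default 0 s i))))" for s
  have S_iff: "S s \<longleftrightarrow> (\<exists>x. x \<in> topspace X \<and> (\<forall>n. Suc n \<in> set s \<longrightarrow> x \<in> B n))" for s
  proof
    assume "S s"
    then obtain c where c: "c \<in> W e" and
      ev: "\<And>i. i < length s \<Longrightarrow> s ! i = 0 \<or> (\<exists>j. evals_list (list_decode c) (goedel cG) j (s ! i))"
      unfolding S_def by (auto simp: nth_default_def)
    have "cylinder (list_decode c) \<inter> dom \<delta> \<noteq> {}" using mem_e[of "list_decode c"] c by simp
    then obtain q x where q: "q \<in> cylinder (list_decode c)" "\<delta> q = Some x" by blast
    obtain r where r: "?\<rho> r = Some x" "\<And>n. evals q cG n (r n)" using G[OF q(2)] by blast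
    have "x \<in> B n" if n: "Suc n \<in> set s" for n
    proof -
      obtain j where "evals_list (list_decode c) (goedel cG) j (Suc n)"
        using n ev by (metis in_set_conv_nth nat.distinct(1))
      then have "r j = n + 1" using evals_functional[OF r(2) evals_list_cylinder[OF _ q(1)]] by simp
      then have "n \<in> enumerated_set r" unfolding enumerated_set_def by blast
      then show ?thesis using r(1) \<rho> by (simp add: canonical_embedding_def)
    qed
    moreover have "x \<in> topspace X" using r(1) by (simp add: \<rho>)
    ultimately show "\<exists>x. x \<in> topspace X \<and> (\<forall>n. Suc n \<in> set s \<longrightarrow> x \<in> B n)" by blast
  next
    assume "\<exists>x. x \<in> topspace X \<and> (\<forall>n. Suc n \<in> set s \<longrightarrow> x \<in> B n)"
    then obtain x where x: "x \<in> topspace X" "\<And>n. Suc n \<in> set s \<Longrightarrow> x \<in> B n" by blast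
    obtain q where q: "\<delta> q = Some x" using x(1) rep unfolding is_representation_def ran_def by blast
    obtain r where r: "?\<rho> r = Some x" "\<And>n. evals q cG n (r n)" using G[OF q] by blast
    have "\<exists>j. v = 0 \<or> r j = v" if "v \<in> set s" for v
    proof (cases v)
      case (Suc n)
      then have "n \<in> enumerated_set r" using r(1) \<rho> x(2) that by (simp add: canonical_embedding_def)
      then show ?thesis using Suc by (auto simp: enumerated_set_def)
    qed simp
    then obtain j where j: "\<And>v. v \<in> set s \<Longrightarrow> v = 0 \<or> r (j v) = v" by metis
    have "\<forall>\<^sub>F m in sequentially. \<forall>v\<in>set s. evals_list (initial q m) (goedel cG) (j v) (r (j v))"
      by (intro eventually_ball_finite ballI eventually_evals_list r(2)) simp
    then obtain m where m: "\<forall>v\<in>set s. evals_list (initial q m) (goedel cG) (j v) (r (j v))"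
      using eventually_happens'[OF sequentially_bot] by blast
    have "list_encode (initial q m) \<in> W e" using q mem_e mem_cylinder_initial by blast
    then show "S s" unfolding S_def
      using m j by (intro exI[of _ "list_encode (initial q m)"]) (auto simp: nth_default_def, metis nth_mem)
  qed
  have "S s \<longleftrightarrow> cylinder s \<inter> dom ?\<rho> \<noteq> {}" for s
    unfolding S_iff standard_representation_cylinder[OF X, symmetric] by blast
  moreover have "semidecidable (\<lambda>z. S (list_decode z))"
    unfolding S_def
    by (intro semidecidable_intros semidecidable_mem_W semidecidable_evals_list
        semidecidable_decidable computable_intros)
  ultimately show ?thesis by simp
qed

section \<open>Effective openness of the standard representation\<close>

text \<open>The binary intersection function is iterated along \<open>s\<close>; an existential
  quantifier over the intermediate indices replaces a recursion on sets.\<close>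

lemma effective_finite_intersection:
  assumes "effective_topological_space X B"
  obtains I where "semidecidable (\<lambda>z. I (list_decode (pfst z)) (psnd z))"
    "\<And>s. {x \<in> topspace X. \<forall>n. Suc n \<in> set s \<longrightarrow> x \<in> B n} = (\<Union>k\<in>{k. I s k}. B k)"
proof -
  obtain f where f: "computable2 f" "\<And>i j. B i \<inter> B j = (\<Union>k\<in>W (f i j). B k)"
    using assms unfolding effective_topological_space_def eff_open_set_def by blast
  have "B i \<subseteq> topspace X" for i
    using assms unfolding effective_topological_space_def by (simp add: openin_subset)
  moreover have "\<exists>i. x \<in> B i" if "x \<in> topspace X" for x
    using assms that openin_topspace[of X] unfolding effective_topological_space_def by blast
  ultimately have top: "topspace X = (\<Union>i. B i)" by blast
  \<comment> \<open>The chain \<open>js\<close> runs from right to left. Its entry at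
    \<open>length s\<close> is arbitrary, since the empty intersection is the whole space and the
    basis covers it; subtracting 1 undoes the shift by which names encode indices.\<close>
  define I where "I s k \<longleftrightarrow> (\<exists>js. nth_default 0 js 0 = k \<and> (\<forall>n<length s.
    (nth_default 0 s n = 0 \<and> nth_default 0 js n = nth_default 0 js (Suc n)) \<or>
    (nth_default 0 s n \<noteq> 0 \<and>
      nth_default 0 js n \<in> W (f (nth_default 0 s n - 1) (nth_default 0 js (Suc n))))))" for s k
  have I_Nil: "I [] k" for k
    unfolding I_def by (rule exI[of _ "[k]"]) (simp add: nth_default_def)
  have I_Cons: "I (v # s) k \<longleftrightarrow> (\<exists>j. I s j \<and> (v = 0 \<and> k = j \<or> v \<noteq> 0 \<and> k \<in> W (f (v - 1) j)))" for v s k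
  proof -
    have tl: "nth_default 0 (tl js) n = nth_default 0 js (Suc n)" for js :: "nat list" and n
      by (cases js) (simp_all add: nth_default_def)
    show ?thesis (is "?L \<longleftrightarrow> ?R")
    proof
      assume ?L
      then obtain js where "nth_default 0 js 0 = k"
        "v = 0 \<and> k = nth_default 0 js 1 \<or> v \<noteq> 0 \<and> k \<in> W (f (v - 1) (nth_default 0 js 1))"
        "\<forall>n<length s. (nth_default 0 s n = 0 \<and> nth_default 0 js (Suc n) = nth_default 0 js (Suc (Suc n))) \<or>
          (nth_default 0 s n \<noteq> 0 \<and>
           nth_default 0 js (Suc n) \<in> W (f (nth_default 0 s n - 1) (nth_default 0 js (Suc (Suc n)))))"
        unfolding I_def by (auto simp: All_less_Suc2)
      then show ?R
        unfolding I_def by (intro exI[of _ "nth_default 0 js 1"] conjI exI[of _ "tl js"]) (simp_all add: tl)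
    next
      assume ?R
      then obtain js where "v = 0 \<and> k = nth_default 0 js 0 \<or> v \<noteq> 0 \<and> k \<in> W (f (v - 1) (nth_default 0 js 0))"
        "\<forall>n<length s. (nth_default 0 s n = 0 \<and> nth_default 0 js n = nth_default 0 js (Suc n)) \<or>
          (nth_default 0 s n \<noteq> 0 \<and>
           nth_default 0 js n \<in> W (f (nth_default 0 s n - 1) (nth_default 0 js (Suc n))))"
        unfolding I_def by auto
      then show ?L
        unfolding I_def by (intro exI[of _ "k # js"]) (simp add: All_less_Suc2)
    qed
  qed
  show ?thesis
  proof (rule that[of I])
    show "semidecidable (\<lambda>z. I (list_decode (pfst z)) (psnd z))"
      unfolding I_def
      by (intro semidecidable_intros semidecidable_mem_W semidecidable_decidable
          computable_compose2[OF f(1)] computable_intros)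
    show "{x \<in> topspace X. \<forall>n. Suc n \<in> set s \<longrightarrow> x \<in> B n} = (\<Union>k\<in>{k. I s k}. B k)" for s
    proof (induction s)
      case Nil
      show ?case by (auto simp: top I_Nil)
    next
      case (Cons v s)
      show ?case
      proof (cases v)
        case 0
        then show ?thesis using Cons by (simp add: I_Cons)
      next
        case (Suc i)
        have "{x \<in> topspace X. \<forall>n. Suc n \<in> set (v # s) \<longrightarrow> x \<in> B n} =
          B i \<inter> {x \<in> topspace X. \<forall>n. Suc n \<in> set s \<longrightarrow> x \<in> B n}"
          using Suc by auto
        also have "\<dots> = (\<Union>j\<in>{j. I s j}. B i \<inter> B j)" unfolding Cons by blast
        also have "\<dots> = (\<Union>k\<in>{k. I (v # s) k}. B k)" using Suc by (auto simp: f(2) I_Cons)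
        finally show ?thesis .
      qed
    qed
  qed
qed

theorem theorem3:
  fixes X :: "'a topology" and B :: "nat \<Rightarrow> 'a set"
    and \<delta> :: "(nat \<Rightarrow> nat) \<rightharpoonup> 'a"
  assumes "effective_topological_space X B"
    and "is_representation X \<delta>"
    and "computably_admissible X B \<delta>"
    and "computably_overt (dom \<delta>)"
    and "Pi02 (dom \<delta>)"
  shows "effective_quasi_Polish X B"
proof (cases "topspace X = {}")
  case True
  then show ?thesis by (simp add: effective_quasi_Polish_def)
next
  case False
  let ?\<rho> = "standard_representation X B"
  note \<rho> = standard_representation_eq_Some[OF assms(1)]
  note \<rho>_cyl = standard_representation_cylinder[OF assms(1)]
  have "dom ?\<rho> \<noteq> {}" using False \<rho>_cyl[of "[]"] by force
  obtain R where R: "semidecidable (\<lambda>z. R (pfst z) (list_decode (psnd z)))"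
    "\<And>n s t. R n s \<Longrightarrow> prefix s t \<Longrightarrow> R n t"
    "\<And>p. p \<in> dom ?\<rho> \<longleftrightarrow> (\<forall>n. \<exists>m. R n (initial p m))"
    using standard_representation_dom_Pi02[OF assms(1,3,5)] by blast
  obtain g H where H: "semidecidable (\<lambda>z. H (list_decode (pfst z)) (list_decode (psnd z)))"
    and range_g: "range g = dom ?\<rho>" and H_ex: "\<And>k. \<exists>s. H k s"
    and g_H: "\<And>k s. H k s \<Longrightarrow> g ` cylinder k = dom ?\<rho> \<inter> cylinder s"
    and H_long: "\<And>q n. \<exists>k s. q \<in> cylinder k \<and> H k s \<and> n \<le> length s"
    by (rule overt_Pi02_effective_image[of R "\<lambda>s. cylinder s \<inter> dom ?\<rho> \<noteq> {}" "dom ?\<rho>"])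
      (rule R(1) R(3) standard_representation_dom_overt[OF assms(1-4)] refl \<open>dom ?\<rho> \<noteq> {}\<close> |
        erule (1) R(2) | blast)+
  define f where "f q = the (?\<rho> (g q))" for q
  have f: "?\<rho> (g q) = Some (f q)" for q
    using range_g unfolding f_def by (metis domIff option.collapse rangeI)
  obtain I where I: "semidecidable (\<lambda>z. I (list_decode (pfst z)) (psnd z))"
    "\<And>s. {x \<in> topspace X. \<forall>n. Suc n \<in> set s \<longrightarrow> x \<in> B n} = (\<Union>k\<in>{k. I s k}. B k)"
    using effective_finite_intersection[OF assms(1)] by blast
  have f_cyl: "f ` cylinder k = {x \<in> topspace X. \<forall>n. Suc n \<in> set s \<longrightarrow> x \<in> B n}" if "H k s" for k s
  proof -
    have "x \<in> f ` cylinder k \<longleftrightarrow> (\<exists>p\<in>cylinder s. ?\<rho> p = Some x)" for x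
    proof -
      have "x \<in> f ` cylinder k \<longleftrightarrow> (\<exists>p\<in>g ` cylinder k. ?\<rho> p = Some x)"
        using f by auto
      then show ?thesis unfolding g_H[OF that] by blast
    qed
    then show ?thesis unfolding \<rho>_cyl by blast
  qed
  show ?thesis
    unfolding effective_quasi_Polish_def
  proof (intro disjI2 exI[of _ f] conjI)
    show "range f = topspace X"
    proof (intro equalityI subsetI)
      fix x assume "x \<in> range f"
      then show "x \<in> topspace X" using f by (auto simp: \<rho>)
    next
      fix x assume "x \<in> topspace X"
      then obtain p where p: "?\<rho> p = Some x" using \<rho>_cyl[of "[]" x] by auto
      then obtain q where "p = g q" using range_g by blast
      then show "x \<in> range f" using p f by (metis option.inject rangeI)
    qed
    \<comment> \<open>Membership in \<open>B i\<close> means that the name \<open>g q\<close> lists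
      \<open>Suc i\<close> at some position; an output prefix longer than that position exhibits it.
      Conversely, \<open>f_cyl\<close> puts the whole image of the input cylinder inside
      \<open>B i\<close>.\<close>
    have f_B: "f q \<in> B i \<longleftrightarrow> (\<exists>k s. q \<in> cylinder k \<and> H k s \<and> Suc i \<in> set s)" for q i
    proof
      assume "f q \<in> B i"
      then have "i \<in> enumerated_set (g q)" using f[of q] \<rho> by (simp add: canonical_embedding_def)
      then obtain n where n: "g q n = Suc i" by (auto simp: enumerated_set_def)
      obtain k s where ks: "q \<in> cylinder k" "H k s" "Suc n \<le> length s" using H_long by blast
      then have "g q \<in> cylinder s" using g_H by blast
      then have "s ! n = Suc i" using n ks(3) by (simp add: cylinder_def)
      then have "Suc i \<in> set s" using ks(3) by (metis Suc_le_lessD nth_mem)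
      then show "\<exists>k s. q \<in> cylinder k \<and> H k s \<and> Suc i \<in> set s" using ks by blast
    qed (use f_cyl in blast)
    show "uniformly_eff_open baire_basis (\<lambda>i. f -` B i)"
    proof (rule uniformly_eff_openI)
      show "semidecidable (\<lambda>z. \<exists>s. H (list_decode (psnd z)) s \<and> Suc (pfst z) \<in> set s)"
        by (intro semidecidable_intros semidecidable_compose2[OF H] semidecidable_decidable computable_intros)
      show "f -` B i = (\<Union>c\<in>{c. \<exists>s. H (list_decode c) s \<and> Suc i \<in> set s}. baire_basis c)" for i
        unfolding baire_basis_def by (auto simp: f_B) (metis list_encode_inverse, blast)
    qed
    show "uniformly_eff_open B (\<lambda>n. f ` cylinder (list_decode n))"
    proof (rule uniformly_eff_openI)
      show "semidecidable (\<lambda>z. \<exists>s. H (list_decode (pfst z)) s \<and> I s (psnd z))"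
        by (intro semidecidable_intros semidecidable_compose2[OF H] semidecidable_compose2[OF I(1)] computable_intros)
      show "f ` cylinder (list_decode c) = (\<Union>k\<in>{k. \<exists>s. H (list_decode c) s \<and> I s k}. B k)" for c
      proof -
        \<comment> \<open>Every \<open>s\<close> related to \<open>c\<close> by \<open>H\<close>
          gives the same union, namely the image, and \<open>H_ex\<close> supplies one; so
          quantifying over \<open>s\<close> neither adds nor loses points.\<close>
        have "f ` cylinder (list_decode c) = (\<Union>k\<in>{k. I s k}. B k)" if "H (list_decode c) s" for s
          using f_cyl[OF that] I(2) by simp
        then have "x \<in> f ` cylinder (list_decode c) \<longleftrightarrow> (\<exists>k. I s k \<and> x \<in> B k)"
          if "H (list_decode c) s" for s x
          using that by simp
        then have "x \<in> f ` cylinder (list_decode c) \<longleftrightarrow> (\<exists>k s. H (list_decode c) s \<and> I s k \<and> x \<in> B k)" for x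
          using H_ex[of "list_decode c"] by metis
        then show ?thesis by blast
      qed
    qed
  qed
qed

end
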